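(* Let $K\subset\mathbb{R}^{2\times 2}$ be a smooth, compact and connected $1$-dimensional submanifold (without boundary) without rank-one connections, and elliptic, i.e. there exists $C_*>0$ such that $|M-M'|^2\leq C_*\det(M-M')$ for all $M,M'\in K$. Then there exist smooth, globally Lipschitz vector fields $G_1,G_2\colon\mathbb{R}^2\to\mathbb{R}^2$ such that $$K\subset\left\{\begin{pmatrix}A\\ iG_1(A)\end{pmatrix}\colon A\in\mathbb{R}^2\right\}\cap\left\{\begin{pmatrix}-iG_2(B)\\ B\end{pmatrix}\colon B\in\mathbb{R}^2\right\},$$ and $G_1,G_2$ are uniformly monotone, that is, for $j=1,2$, $$(G_j(X)-G_j(X'))\cdot(X-X')\geq\lambda|X-X'|^2\qquad\forall X,X'\in\mathbb{R}^2,$$ for some constant $\lambda>0$ depending only on $K$.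
   Context: $|\cdot|$ is the Euclidean norm (on $\mathbb{R}^{2\times 2}$, the Hilbert-Schmidt norm). "Without rank-one connections" means that there are no $M,M'\in K$ with $\operatorname{rank}(M-M')=1$. $\mathbb{R}^2$ is identified with $\mathbb{C}$, so that $i(x,y)=(-y,x)$. For $A,B\in\mathbb{R}^2$, $\begin{pmatrix}A\\ B\end{pmatrix}$ denotes the $2\times 2$ matrix with first row $A$ and second row $B$. *)

theory Defs
  imports "HOL-Analysis.Analysis"
begin

(* C^n regularity, meant for open S only: "differentiable (at x)" refers to a full neighbourhood
   of x. A map of class C^(n+1) is one all of whose directional derivatives x \<mapsto> Df(x) v
   are of class C^n. *)
primrec Ck_on :: "nat \<Rightarrow> ('a::euclidean_space \<Rightarrow> 'b::euclidean_space) \<Rightarrow> 'a set \<Rightarrow> bool" where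
  "Ck_on 0 f S \<longleftrightarrow> continuous_on S f"
| "Ck_on (Suc n) f S \<longleftrightarrow>
     (\<forall>x\<in>S. f differentiable (at x)) \<and>
     (\<forall>v. Ck_on n (\<lambda>x. frechet_derivative f (at x) v) S)"

definition smooth_on :: "('a::euclidean_space \<Rightarrow> 'b::euclidean_space) \<Rightarrow> 'a set \<Rightarrow> bool" where
  "smooth_on f S \<longleftrightarrow> (\<forall>n. Ck_on n f S)"

(* Embedded k-dimensional submanifold without boundary, by slice charts: near each of its points,
   K is mapped onto an open piece of a k-dimensional linear subspace E by a smooth diffeomorphism
   \<phi> (with inverse \<psi>) between open sets of the ambient space. *)
definition smooth_submanifold :: "nat \<Rightarrow> 'a::euclidean_space set \<Rightarrow> bool" where
  "smooth_submanifold k K \<longleftrightarrow>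
     (\<forall>p\<in>K. \<exists>(U :: 'a set) (V :: 'a set) \<phi> \<psi> E.
        open U \<and> p \<in> U \<and> open V \<and>
        homeomorphism U V \<phi> \<psi> \<and> smooth_on \<phi> U \<and> smooth_on \<psi> V \<and>
        subspace E \<and> dim E = k \<and> \<phi> ` (U \<inter> K) = V \<inter> E)"

definition no_rank_one_connections :: "(real^2^2) set \<Rightarrow> bool" where
  "no_rank_one_connections K \<longleftrightarrow> \<not> (\<exists>M\<in>K. \<exists>M'\<in>K. rank (M - M') = 1)"

(* The norm of real^2^2 is the Hilbert-Schmidt norm. *)
definition elliptic :: "(real^2^2) set \<Rightarrow> bool" where
  "elliptic K \<longleftrightarrow> (\<exists>C>0. \<forall>M\<in>K. \<forall>M'\<in>K. (norm (M - M'))\<^sup>2 \<le> C * det (M - M'))"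

(* Multiplication by the imaginary unit under the identification of the plane with the complex
   numbers. *)
definition mult_i :: "real^2 \<Rightarrow> real^2" where
  "mult_i v = vector [- (v $ 2), v $ 1]"

(* M $ i is the i-th row of a matrix M, so A is the first row and B the second. *)
definition matrix_of_rows :: "real^2 \<Rightarrow> real^2 \<Rightarrow> real^2^2" where
  "matrix_of_rows A B = vector [A, B]"

definition uniformly_monotone :: "real \<Rightarrow> (real^2 \<Rightarrow> real^2) \<Rightarrow> bool" where
  "uniformly_monotone l G \<longleftrightarrow> (\<forall>X X'. (G X - G X') \<bullet> (X - X') \<ge> l * (norm (X - X'))\<^sup>2)"

end

theory Submission
  imports Defs
begin

text \<open>
  With the field \<open>g(M)\<close> equal to \<open>-i\<close> times the second row of \<open>M\<close> (for \<open>G1\<close>) or \<open>i\<close> times the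
  first row (for \<open>G2\<close>), and \<open>P(M)\<close> the other row, the determinant is the inner product
  \<open>det M = g(M) \<bullet> P(M)\<close>. Ellipticity therefore reads
  \<open>|\<Delta>P|\<^sup>2 + |\<Delta>g|\<^sup>2 \<le> 2 m (\<Delta>g \<bullet> \<Delta>P)\<close> on \<open>K\<close>, where \<open>2 m > 2\<close> is an ellipticity constant. Completing the
  square, this is \<open>|\<Delta>g - m \<Delta>P| \<le> k |\<Delta>P|\<close> with \<open>k = sqrt(m\<^sup>2 - 1) < m\<close>: on the plane curve
  \<open>T = P(K)\<close> the map \<open>g - m P\<close> is a \<open>k\<close>-Lipschitz function \<open>f\<close> of the point. If \<open>H\<close> is a smooth
  extension of \<open>f\<close> to the plane whose Lipschitz constant is still below \<open>m\<close>, then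
  \<open>G(x) = m x + H(x)\<close> is smooth, Lipschitz and uniformly monotone, and \<open>G(P M) = g(M)\<close> on \<open>K\<close>
  (lemma \<open>smooth_monotone_field\<close>).

  So the task is to extend \<open>f\<close> smoothly and exactly while increasing the Lipschitz constant by an
  arbitrarily small amount only (\<open>smooth_lipschitz_extension\<close>). Two extensions are available. One is
  Kirszbraun's (\<open>kirszbraun\<close>): it is global with the optimal constant, and mollifying it makes it
  smooth but destroys the values on \<open>T\<close>. The other one is local: near a point of the curve, \<open>T\<close> is
  a graph over its tangent line, and composing with the projection to this line extends \<open>f\<close>
  smoothly, with a derivative bound that is almost \<open>k\<close> near the point
  (\<open>smooth_extension_near_projected_curve\<close>). Gluing two such extensions with a cutoff does not
  worsen the bound at points of \<open>T\<close>, because the term that contains the derivative of the cutoff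
  is multiplied by the difference of the extensions, which is zero on \<open>T\<close>
  (\<open>smooth_extension_near_Un\<close>); by compactness there is a smooth map \<open>F0\<close> which equals \<open>f\<close> on all of
  \<open>T\<close> and has an almost optimal derivative bound close to \<open>T\<close>.

  Passing from \<open>F0\<close> near \<open>T\<close> to a mollified Kirszbraun extension away from \<open>T\<close> by a cutoff at
  distance \<open>\<delta>\<close> costs an error in the derivative: the cutoff has slope of order \<open>1/\<delta>\<close> and the two maps
  differ by order \<open>\<delta>\<close>. This error is bounded independently of \<open>\<delta>\<close>, but it is not small. It lives,
  however, only on a shell where the distance to \<open>T\<close> is comparable to \<open>\<delta>\<close>. Taking the average
  over \<open>n\<close> scales with disjoint shells makes the error \<open>O(1/n)\<close> everywhere.
\<close>

section \<open>Calculus of smooth maps\<close>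

lemma Ck_on_cong:
  assumes "open S" "\<And>x. x \<in> S \<Longrightarrow> f x = g x"
  shows "Ck_on n f S \<longleftrightarrow> Ck_on n g S"
  using assms(2)
proof (induction n arbitrary: f g)
  case 0
  then show ?case by (simp cong: continuous_on_cong)
next
  case (Suc n)
  have D: "(f has_derivative D) (at x) \<longleftrightarrow> (g has_derivative D) (at x)" if "x \<in> S" for x D
    using has_derivative_transform_within_open[OF _ assms(1) that] Suc.prems by metis
  have "frechet_derivative f (at x) = frechet_derivative g (at x)" if "x \<in> S" for x
    using D[OF that] by (simp add: frechet_derivative_def)
  moreover have "f differentiable (at x) \<longleftrightarrow> g differentiable (at x)" if "x \<in> S" for x
    using D[OF that] by (simp add: differentiable_def)
  ultimately show ?case
    using Suc.IH[of "\<lambda>x. frechet_derivative f (at x) v" "\<lambda>x. frechet_derivative g (at x) v" for v]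
    by simp
qed

lemma Ck_on_subset: "Ck_on n f S \<Longrightarrow> T \<subseteq> S \<Longrightarrow> Ck_on n f T"
  by (induction n arbitrary: f) (auto intro: continuous_on_subset)

lemma Ck_on_local:
  assumes "\<And>x. x \<in> S \<Longrightarrow> \<exists>T. open T \<and> x \<in> T \<and> Ck_on n f T"
  shows "Ck_on n f S"
  using assms
proof (induction n arbitrary: f)
  case 0
  have "continuous (at x) f" if "x \<in> S" for x
    using 0[OF that] by (auto simp: continuous_on_eq_continuous_at)
  then show ?case by (simp add: continuous_at_imp_continuous_on)
next
  case (Suc n)
  have "Ck_on n (\<lambda>x. frechet_derivative f (at x) v) S" for v
    by (rule Suc.IH) (use Suc.prems in fastforce)
  moreover have "f differentiable (at x)" if "x \<in> S" for x
    using Suc.prems[OF that] by auto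
  ultimately show ?case by simp
qed

lemma Ck_on_SucI:
  assumes "open S" "\<And>x. x \<in> S \<Longrightarrow> (f has_derivative f' x) (at x)"
    and "\<And>v. Ck_on n (\<lambda>x. f' x v) S"
  shows "Ck_on (Suc n) f S"
proof -
  have "frechet_derivative f (at x) = f' x" if "x \<in> S" for x
    using frechet_derivative_at[OF assms(2)[OF that]] by simp
  then have "Ck_on n (\<lambda>x. frechet_derivative f (at x) v) S" for v
    using Ck_on_cong[OF assms(1), of "\<lambda>x. frechet_derivative f (at x) v" "\<lambda>x. f' x v"] assms(3)
    by simp
  then show ?thesis using assms(2) by (auto simp: differentiable_def)
qed

lemma Ck_on_SucD:
  "Ck_on (Suc n) f S \<Longrightarrow> Ck_on n f S"
proof (induction n arbitrary: f)
  case 0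
  then have "\<forall>x\<in>S. f differentiable (at x)"
    by simp
  then have "\<forall>x\<in>S. isCont f x"
    using differentiable_imp_continuous_within by blast
  then show ?case by (simp add: continuous_at_imp_continuous_on)
next
  case (Suc n)
  have "\<forall>x\<in>S. f differentiable (at x)" "\<forall>v. Ck_on (Suc n) (\<lambda>x. frechet_derivative f (at x) v) S"
    using Suc.prems Ck_on.simps(2) by blast+
  then show ?case using Suc.IH Ck_on.simps(2) by blast
qed

lemma Ck_on_const: "Ck_on n (\<lambda>x. c) S"
  by (induction n arbitrary: c) (auto simp: frechet_derivative_const)

lemma Ck_on_linear:
  assumes "bounded_linear L" shows "Ck_on n L S"
proof (cases n)
  case 0
  then show ?thesis using assms linear_continuous_on by auto
next
  case (Suc m)
  have "frechet_derivative L (at x) = L" for x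
    using frechet_derivative_at[OF bounded_linear_imp_has_derivative[OF assms]] by metis
  then show ?thesis
    using Suc Ck_on_const bounded_linear_imp_differentiable[OF assms] by auto
qed

lemma Ck_on_add:
  assumes "open S" "Ck_on n f S" "Ck_on n g S"
  shows "Ck_on n (\<lambda>x. f x + g x) S"
  using assms(2,3)
proof (induction n arbitrary: f g)
  case 0
  then show ?case by (auto intro: continuous_on_add)
next
  case (Suc n)
  show ?case
  proof (rule Ck_on_SucI[OF assms(1)])
    show "((\<lambda>x. f x + g x) has_derivative
      (\<lambda>v. frechet_derivative f (at x) v + frechet_derivative g (at x) v)) (at x)" if "x \<in> S" for x
      using Suc.prems that by (auto intro!: has_derivative_add simp: frechet_derivative_works)
    show "Ck_on n (\<lambda>x. frechet_derivative f (at x) v + frechet_derivative g (at x) v) S" for v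
      using Suc.prems by (intro Suc.IH) auto
  qed
qed

lemma Ck_on_sum:
  assumes "open S" "\<And>i. i \<in> I \<Longrightarrow> Ck_on n (f i) S"
  shows "Ck_on n (\<lambda>x. \<Sum>i\<in>I. f i x) S"
  using assms(2)
  by (induction I rule: infinite_finite_induct) (auto intro: Ck_on_add assms(1) Ck_on_const)

lemma Ck_on_bilinear:
  assumes "bounded_bilinear B" "open S" "Ck_on n f S" "Ck_on n g S"
  shows "Ck_on n (\<lambda>x. B (f x) (g x)) S"
  using assms(3,4)
proof (induction n arbitrary: f g)
  case 0
  then show ?case using bounded_bilinear.continuous_on[OF assms(1)] by auto
next
  case (Suc n)
  let ?D = "\<lambda>f x. frechet_derivative f (at x)"
  show ?case
  proof (rule Ck_on_SucI[OF assms(2)])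
    show "((\<lambda>x. B (f x) (g x)) has_derivative
      (\<lambda>v. B (f x) (?D g x v) + B (?D f x v) (g x))) (at x)" if "x \<in> S" for x
      using Suc.prems that
      by (auto intro!: bounded_bilinear.FDERIV[OF assms(1)] simp: frechet_derivative_works)
    show "Ck_on n (\<lambda>x. B (f x) (?D g x v) + B (?D f x v) (g x)) S" for v
      using Suc.prems Ck_on_SucD[OF Suc.prems(1)] Ck_on_SucD[OF Suc.prems(2)]
      by (intro Ck_on_add[OF assms(2)] Suc.IH) auto
  qed
qed

lemma Ck_on_compose_linear:
  assumes "bounded_linear L" "open S" "Ck_on n f S"
  shows "Ck_on n (\<lambda>x. L (f x)) S"
  using assms(3)
proof (induction n arbitrary: f)
  case 0
  then show ?case using bounded_linear.continuous_on[OF assms(1)] by auto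
next
  case (Suc n)
  show ?case
  proof (rule Ck_on_SucI[OF assms(2)])
    show "((\<lambda>x. L (f x)) has_derivative (\<lambda>v. L (frechet_derivative f (at x) v))) (at x)"
      if "x \<in> S" for x
      using Suc.prems that
      by (auto intro!: bounded_linear.has_derivative[OF assms(1)] simp: frechet_derivative_works)
    show "Ck_on n (\<lambda>x. L (frechet_derivative f (at x) v)) S" for v
      using Suc.prems by (intro Suc.IH) auto
  qed
qed

text \<open>The chain rule writes a directional derivative of a composition through the finitely many partial
  derivatives of the outer map. Their coefficients are components of derivatives of the inner map,
  so the induction hypothesis, applied to each partial derivative, closes the argument.\<close>

lemma Ck_on_compose:
  fixes g :: "'a::euclidean_space \<Rightarrow> 'b::euclidean_space" and f :: "'b \<Rightarrow> 'c::euclidean_space"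
  assumes "open S" "open T" "g ` S \<subseteq> T" "Ck_on n f T" "Ck_on n g S"
  shows "Ck_on n (\<lambda>x. f (g x)) S"
  using assms(4,5)
proof (induction n arbitrary: f)
  case 0
  then show ?case using assms(3) continuous_on_compose2 by auto
next
  case (Suc n)
  let ?D = "\<lambda>f x. frechet_derivative f (at x)"
  have lin: "bounded_linear (?D f y)" if "y \<in> T" for y
    using Suc.prems(1) that has_derivative_bounded_linear[OF iffD1[OF frechet_derivative_works]] by auto
  show ?case
  proof (rule Ck_on_SucI[OF assms(1)])
    fix x assume x: "x \<in> S"
    have der: "((\<lambda>x. f (g x)) has_derivative (\<lambda>v. ?D f (g x) (?D g x v))) (at x)"
    proof (rule has_derivative_compose[where g=f])
      show "(g has_derivative ?D g x) (at x)"
        using Suc.prems(2) x frechet_derivative_works by auto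
      have "g x \<in> T" using x assms(3) by blast
      then show "(f has_derivative ?D f (g x)) (at (g x))"
        using Suc.prems(1) frechet_derivative_works by auto
    qed
    have rep: "?D f (g x) w = (\<Sum>b\<in>Basis. (w \<bullet> b) *\<^sub>R ?D f (g x) b)" for w
    proof -
      have "linear (?D f (g x))" using lin x assms(3) bounded_linear.linear by blast
      from linear_sum[OF this, of "\<lambda>b. (w \<bullet> b) *\<^sub>R b" Basis] linear_scale[OF this]
      show ?thesis by (simp add: euclidean_representation)
    qed
    show "((\<lambda>x. f (g x)) has_derivative
        (\<lambda>v. \<Sum>b\<in>Basis. (?D g x v \<bullet> b) *\<^sub>R ?D f (g x) b)) (at x)"
      unfolding rep[symmetric] by (rule der)
  next
    fix v
    show "Ck_on n (\<lambda>x. \<Sum>b\<in>Basis. (?D g x v \<bullet> b) *\<^sub>R ?D f (g x) b) S"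
      using Suc.prems
      by (intro Ck_on_sum Ck_on_bilinear[OF bounded_bilinear_scaleR] assms(1)
        Ck_on_compose_linear[OF bounded_linear_inner_left] Suc.IH Ck_on_SucD[OF Suc.prems(2)]) auto
  qed
qed

lemma smooth_onD:
  assumes "smooth_on f S" "x \<in> S"
  shows "(f has_derivative frechet_derivative f (at x)) (at x)"
  using assms unfolding smooth_on_def
  by (metis Ck_on.simps(2) frechet_derivative_works)

lemma smooth_on_deriv:
  assumes "smooth_on f S" shows "smooth_on (\<lambda>x. frechet_derivative f (at x) v) S"
  using assms unfolding smooth_on_def by (metis Ck_on.simps(2))

lemma smooth_on_continuous: "smooth_on f S \<Longrightarrow> continuous_on S f"
  unfolding smooth_on_def by (metis Ck_on.simps(1))

lemma smooth_on_subset: "smooth_on f S \<Longrightarrow> T \<subseteq> S \<Longrightarrow> smooth_on f T"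
  unfolding smooth_on_def using Ck_on_subset by blast

lemma smooth_on_cong: 
  "open S \<Longrightarrow> (\<And>x. x \<in> S \<Longrightarrow> f x = g x) \<Longrightarrow> smooth_on f S \<longleftrightarrow> smooth_on g S"
  unfolding smooth_on_def using Ck_on_cong by blast

lemma smooth_on_open_Un:
  "open S \<Longrightarrow> open T \<Longrightarrow> smooth_on f S \<Longrightarrow> smooth_on f T \<Longrightarrow> smooth_on f (S \<union> T)"
  unfolding smooth_on_def by (meson Ck_on_local UnE)

lemma smooth_on_const: "smooth_on (\<lambda>x. c) S"
  unfolding smooth_on_def using Ck_on_const by blast

lemma smooth_on_linear: "bounded_linear L \<Longrightarrow> smooth_on L S"
  unfolding smooth_on_def using Ck_on_linear by blast

lemma smooth_on_add:
  "open S \<Longrightarrow> smooth_on f S \<Longrightarrow> smooth_on g S \<Longrightarrow> smooth_on (\<lambda>x. f x + g x) S"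
  unfolding smooth_on_def using Ck_on_add by blast

lemma smooth_on_bilinear:
  "bounded_bilinear B \<Longrightarrow> open S \<Longrightarrow> smooth_on f S \<Longrightarrow> smooth_on g S \<Longrightarrow> smooth_on (\<lambda>x. B (f x) (g x)) S"
  unfolding smooth_on_def using Ck_on_bilinear by blast

lemmas smooth_on_scaleR = smooth_on_bilinear[OF bounded_bilinear_scaleR]

lemma smooth_on_sum:
  "open S \<Longrightarrow> (\<And>i. i \<in> I \<Longrightarrow> smooth_on (f i) S) \<Longrightarrow> smooth_on (\<lambda>x. \<Sum>i\<in>I. f i x) S"
  unfolding smooth_on_def by (auto intro: Ck_on_sum)

lemma smooth_on_diff:
  assumes "open S" "smooth_on f S" "smooth_on g S"
  shows "smooth_on (\<lambda>x. f x - g x) S"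
  using smooth_on_add[OF assms(1,2) smooth_on_scaleR[OF assms(1) smooth_on_const[of "-1::real"] assms(3)]]
  by simp

lemma smooth_on_compose:
  "open S \<Longrightarrow> open T \<Longrightarrow> g ` S \<subseteq> T \<Longrightarrow> smooth_on f T \<Longrightarrow> smooth_on g S \<Longrightarrow> smooth_on (\<lambda>x. f (g x)) S"
  unfolding smooth_on_def using Ck_on_compose by blast

section \<open>Smooth mollifiers\<close>

text \<open>All functions \<open>exp(-1/t)/t^k\<close> are treated together: the derivative of one of them is a linear
  combination of two others, so that their smoothness follows by a single induction.\<close>

definition flat_exp :: "nat \<Rightarrow> real \<Rightarrow> real" where
  "flat_exp k t = (if t \<le> 0 then 0 else exp (- 1 / t) / t ^ k)"

text \<open>The left side, divided by \<open>n!\<close>, is one of the nonnegative terms of the exponential series.\<close>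

lemma power_le_fact_exp:
  fixes u :: real assumes "0 \<le> u" shows "u ^ n \<le> fact n * exp u"
proof -
  have s: "(\<lambda>n. u ^ n /\<^sub>R fact n) sums exp u" by (rule exp_converges)
  have "sum (\<lambda>n. u ^ n /\<^sub>R fact n) {n} \<le> (\<Sum>n. u ^ n /\<^sub>R fact n)"
    using assms s by (intro sum_le_suminf) (auto simp: sums_iff)
  then have "u ^ n / fact n \<le> exp u" using s by (simp add: sums_iff divide_inverse mult.commute)
  then show ?thesis by (simp add: field_simps)
qed

text \<open>A bound quadratic in \<open>t\<close> makes the difference quotients at \<open>0\<close> tend to \<open>0\<close>; it comes from
  comparing \<open>exp(1/t)\<close> with the power \<open>(1/t)^(k+2)\<close>.\<close>

lemma flat_exp_bound: "0 \<le> flat_exp k t" "flat_exp k t \<le> fact (k + 2) * t\<^sup>2"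
proof -
  show "0 \<le> flat_exp k t" by (simp add: flat_exp_def)
  show "flat_exp k t \<le> fact (k + 2) * t\<^sup>2"
  proof (cases "t \<le> 0")
    case False
    have "(1 / t) ^ (k + 2) \<le> fact (k + 2) * exp (1 / t)"
      using False by (intro power_le_fact_exp) auto
    from mult_left_mono[OF this, of "exp (- 1 / t)"]
    have "exp (- 1 / t) * (1 / t) ^ (k + 2) \<le> fact (k + 2) * (exp (1 / t) * exp (- 1 / t))"
      by (simp only: exp_ge_zero mult.left_commute mult.commute simp_thms True_implies_equals)
    also have "exp (1 / t) * exp (- 1 / t) = 1" by (simp flip: exp_add)
    finally show ?thesis using False
      by (simp add: flat_exp_def field_simps power_add power2_eq_square del: fact_Suc)
  qed (simp add: flat_exp_def)
qed

lemma flat_exp_deriv: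
  "(flat_exp k has_real_derivative (flat_exp (k + 2) t - real k * flat_exp (k + 1) t)) (at t)"
proof -
  consider "t < 0" | "t = 0" | "t > 0" by linarith
  then show ?thesis
  proof cases
    case 1
    have "((\<lambda>_. 0) has_real_derivative 0) (at t)" by simp
    moreover have "(0::real) = flat_exp k s" if "s \<in> {..<0}" for s
      using that by (simp add: flat_exp_def)
    ultimately have "(flat_exp k has_real_derivative 0) (at t)"
      using 1 by (elim has_field_derivative_transform_within_open[where S="{..<0}"]) auto
    then show ?thesis using 1 by (simp add: flat_exp_def)
  next
    case 2
    have "((\<lambda>h. (flat_exp k (0 + h) - flat_exp k 0) / h) \<longlongrightarrow> 0) (at 0)"
    proof (rule Lim_null_comparison)
      show "\<forall>\<^sub>F h in at 0. norm ((flat_exp k (0 + h) - flat_exp k 0) / h) \<le> fact (k + 2) * \<bar>h\<bar>"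
        unfolding eventually_at_filter
      proof (rule always_eventually, intro allI impI)
        fix h :: real assume "h \<noteq> 0"
        have "\<bar>flat_exp k h\<bar> \<le> fact (k + 2) * (\<bar>h\<bar> * \<bar>h\<bar>)"
          using flat_exp_bound[of k h] by (simp add: power2_eq_square flip: abs_mult)
        then have "\<bar>flat_exp k h\<bar> / \<bar>h\<bar> \<le> fact (k + 2) * \<bar>h\<bar>"
          using \<open>h \<noteq> 0\<close> by (simp add: field_simps del: fact_Suc)
        then show "norm ((flat_exp k (0 + h) - flat_exp k 0) / h) \<le> fact (k + 2) * \<bar>h\<bar>"
          by (simp add: flat_exp_def[of k 0] del: fact_Suc)
      qed
      show "((\<lambda>h. fact (k + 2) * \<bar>h\<bar>) \<longlongrightarrow> (0::real)) (at 0)"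
        by (auto intro!: tendsto_eq_intros)
    qed
    then show ?thesis using 2 by (simp add: DERIV_def flat_exp_def)
  next
    case 3
    have "((\<lambda>t. exp (- 1 / t) / t ^ k) has_real_derivative
        (flat_exp (k + 2) t - real k * flat_exp (k + 1) t)) (at t)"
      using 3 by (auto intro!: derivative_eq_intros simp: flat_exp_def)
        (cases k; simp add: field_simps power2_eq_square)
    moreover have "exp (- 1 / s) / s ^ k = flat_exp k s" if "s \<in> {0<..}" for s
      using that by (simp add: flat_exp_def)
    ultimately show ?thesis
      using 3 by (elim has_field_derivative_transform_within_open[where S="{0<..}"]) auto
  qed
qed

lemma smooth_flat_exp: "smooth_on (flat_exp k) UNIV"
proof -
  have "Ck_on n (flat_exp k) UNIV" for n k
  proof (induction n arbitrary: k)
    case 0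
    show ?case using flat_exp_deriv DERIV_isCont by (force intro: continuous_at_imp_continuous_on)
  next
    case (Suc n)
    show ?case
    proof (rule Ck_on_SucI)
      show "(flat_exp k has_derivative (\<lambda>v. v *\<^sub>R (flat_exp (k + 2) t + (- real k) *\<^sub>R flat_exp (k + 1) t))) (at t)" for t
        using flat_exp_deriv[of k t] by (simp add: has_field_derivative_def mult.commute[of _ "_ - _"] mult_commute_abs)
      show "Ck_on n (\<lambda>t. v *\<^sub>R (flat_exp (k + 2) t + (- real k) *\<^sub>R flat_exp (k + 1) t)) UNIV" for v
        by (intro Ck_on_bilinear[OF bounded_bilinear_scaleR] Ck_on_add Suc.IH Ck_on_const) auto
    qed auto
  qed
  then show ?thesis by (simp add: smooth_on_def)
qed

abbreviation centered_cube :: "real \<Rightarrow> 'a::euclidean_space set" where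
  "centered_cube e \<equiv> cbox (- (e *\<^sub>R One)) (e *\<^sub>R One)"

lemma ball_subset_centered_cube: "norm z < e \<Longrightarrow> z \<in> centered_cube e"
  using Basis_le_norm[of _ z] by (force simp: mem_box abs_le_iff)

text \<open>The rotationally symmetric bump \<open>flat_exp 0 (e\<^sup>2 - |z|\<^sup>2)\<close>, normalised. Integrals are taken over a
  cube that contains its support, since integration theory is most convenient over boxes.\<close>

lemma ex_mollifier:
  assumes "0 < e"
  obtains \<rho> :: "'a::euclidean_space \<Rightarrow> real" where "smooth_on \<rho> UNIV" "\<And>z. 0 \<le> \<rho> z"
    "\<And>z. e \<le> norm z \<Longrightarrow> \<rho> z = 0" "(\<rho> has_integral 1) (centered_cube e)"
proof -
  let ?C = "centered_cube e :: 'a set"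
  define b :: "'a \<Rightarrow> real" where "b z = flat_exp 0 (e\<^sup>2 - z \<bullet> z)" for z
  have sm: "smooth_on b UNIV"
    unfolding b_def
  proof (rule smooth_on_compose[OF _ _ _ smooth_flat_exp])
    show "smooth_on (\<lambda>z::'a. e\<^sup>2 - z \<bullet> z) UNIV"
      by (intro smooth_on_diff smooth_on_const smooth_on_bilinear[OF bounded_bilinear_inner]
          smooth_on_linear bounded_linear_ident open_UNIV)
  qed auto
  have nonneg: "0 \<le> b z" for z by (simp add: b_def flat_exp_bound)
  have b0: "b 0 > 0" using assms by (simp add: b_def flat_exp_def)
  have supp: "b z = 0" if "e \<le> norm z" for z
  proof -
    have "e\<^sup>2 \<le> (norm z)\<^sup>2" using that assms by (simp add: power_mono)
    then show ?thesis by (simp add: b_def flat_exp_def power2_norm_eq_inner)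
  qed
  have cont: "continuous_on ?C b" using smooth_on_continuous[OF sm] continuous_on_subset by blast
  then have int: "b integrable_on ?C" by (rule integrable_continuous)
  have "integral ?C b \<noteq> 0"
  proof
    assume "integral ?C b = 0"
    then have "(b has_integral 0) ?C" using int by (simp add: has_integral_iff)
    then have "b 0 = 0"
      using assms
      by (intro has_integral_0_cbox_imp_0[OF cont nonneg]) (auto simp: box_ne_empty mem_box)
    then show False using b0 by simp
  qed
  then have pos: "0 < integral ?C b"
    using integral_nonneg[OF int] nonneg by (simp add: order_less_le)
  show thesis
  proof (rule that[of "\<lambda>z. inverse (integral ?C b) *\<^sub>R b z"])
    show "smooth_on (\<lambda>z. inverse (integral ?C b) *\<^sub>R b z) UNIV"
      by (intro smooth_on_scaleR smooth_on_const sm open_UNIV)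
    show "((\<lambda>z. inverse (integral ?C b) *\<^sub>R b z) has_integral 1) ?C"
      using has_integral_mult_right[OF integrable_integral[OF int], of "inverse (integral ?C b)"] pos
      by simp
  qed (use pos nonneg supp in auto)
qed

text \<open>Differentiation under the integral sign moves every derivative to the kernel, which stays smooth;
  hence an induction over the order, for all kernels at once.\<close>

lemma smooth_on_convolution:
  fixes \<rho> :: "'a::euclidean_space \<Rightarrow> real" and F :: "'a \<Rightarrow> 'b::euclidean_space"
  assumes \<rho>: "smooth_on \<rho> UNIV" and F: "continuous_on UNIV F"
  shows "smooth_on (\<lambda>x. integral (cbox a b) (\<lambda>y. \<rho> (x - y) *\<^sub>R F y)) UNIV"
proof -
  have "Ck_on n (\<lambda>x. integral (cbox a b) (\<lambda>y. \<rho> (x - y) *\<^sub>R F y)) UNIV" 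
    if "smooth_on \<rho> UNIV" for n and \<rho> :: "'a \<Rightarrow> real"
    using that
  proof (induction n arbitrary: \<rho>)
    case 0
    have c: "continuous_on UNIV \<rho>" using 0 by (rule smooth_on_continuous)
    have "continuous_on (UNIV \<times> cbox a b) (\<lambda>(x, y). \<rho> (x - y) *\<^sub>R F y)"
      unfolding split_beta
      by (intro continuous_intros continuous_on_compose2[OF c] continuous_on_compose2[OF F]) auto
    then show ?case by (simp add: integral_continuous_on_param)
  next
    case (Suc n)
    let ?D = "\<lambda>z. frechet_derivative \<rho> (at z)"
    have c: "continuous_on UNIV \<rho>" using Suc.prems by (rule smooth_on_continuous)
    have cD: "continuous_on UNIV (\<lambda>z. ?D z v)" for v
      using smooth_on_continuous[OF smooth_on_deriv[OF Suc.prems]] .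
    have der: "(\<rho> has_derivative ?D z) (at z)" for z using smooth_onD[OF Suc.prems] by simp
    have "bounded_linear (\<lambda>v. ?D z v *\<^sub>R w)" for z and w :: 'b
      using bounded_linear_compose[OF bounded_linear_scaleR_left has_derivative_bounded_linear[OF der]] .
    note bl = bounded_linear_Blinfun_apply[OF this]
    define fx where "fx x y = Blinfun (\<lambda>v. ?D (x - y) v *\<^sub>R F y)" for x y
    have fx: "blinfun_apply (fx x y) v = ?D (x - y) v *\<^sub>R F y" for x y v
      unfolding fx_def bl ..
    have cont: "continuous_on (UNIV \<times> cbox a b) (\<lambda>(x, y). fx x y)"
      unfolding split_beta
      by (intro continuous_on_blinfun_componentwise)
        (auto simp: fx intro!: continuous_intros continuous_on_compose2[OF cD] continuous_on_compose2[OF F])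
    have "fx x integrable_on cbox a b" for x
      by (rule integrable_continuous)
        (use continuous_on_compose2[OF cont, of "cbox a b" "\<lambda>y. (x, y)"] in
          \<open>auto simp: continuous_on_Pair continuous_on_id\<close>)
    then have int: "blinfun_apply (integral (cbox a b) (fx x)) v
        = integral (cbox a b) (\<lambda>y. ?D (x - y) v *\<^sub>R F y)" for x v
      by (simp add: blinfun_apply_integral fx)
    show ?case
    proof (rule Ck_on_SucI)
      fix x :: 'a
      have "((\<lambda>x. integral (cbox a b) (\<lambda>y. \<rho> (x - y) *\<^sub>R F y)) has_derivative
          blinfun_apply (integral (cbox a b) (fx x))) (at x within UNIV)"
      proof (rule leibniz_rule)
        fix x t :: 'a
        show "((\<lambda>x. \<rho> (x - t) *\<^sub>R F t) has_derivative blinfun_apply (fx x t)) (at x within UNIV)"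
          unfolding fx[abs_def]
          by (rule has_derivative_scaleR_left, rule has_derivative_compose[OF _ der])
            (auto intro!: derivative_eq_intros)
        show "(\<lambda>y. \<rho> (x - y) *\<^sub>R F y) integrable_on cbox a b"
          by (intro integrable_continuous continuous_intros continuous_on_compose2[OF c]
              continuous_on_compose2[OF F]) auto
      qed (use cont in auto)
      then show "((\<lambda>x. integral (cbox a b) (\<lambda>y. \<rho> (x - y) *\<^sub>R F y)) has_derivative
          (\<lambda>v. integral (cbox a b) (\<lambda>y. ?D (x - y) v *\<^sub>R F y))) (at x)"
        unfolding int[abs_def] .
    next
      fix v
      show "Ck_on n (\<lambda>x. integral (cbox a b) (\<lambda>y. ?D (x - y) v *\<^sub>R F y)) UNIV"
        using Suc.IH smooth_on_deriv[OF Suc.prems] .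
    qed simp
  qed
  then show ?thesis using \<rho> by (simp add: smooth_on_def)
qed

text \<open>In this form, with the kernel centred at the origin, the Lipschitz constant of \<open>F\<close> is visibly
  inherited, but the smoothness is not visible. While \<open>x\<close> stays in a unit ball, the substitution
  \<open>y = x - z\<close> turns the integral into a convolution over one fixed box.\<close>

lemma smooth_on_mollification:
  fixes \<rho> :: "'a::euclidean_space \<Rightarrow> real" and F :: "'a \<Rightarrow> 'b::euclidean_space"
  assumes e: "0 < e" and \<rho>: "smooth_on \<rho> UNIV" and supp: "\<And>z. e \<le> norm z \<Longrightarrow> \<rho> z = 0"
    and F: "continuous_on UNIV F"
  shows "smooth_on (\<lambda>x. integral (centered_cube e) (\<lambda>z. \<rho> z *\<^sub>R F (x - z))) UNIV"
proof -
  let ?G = "\<lambda>x. integral (centered_cube e) (\<lambda>z. \<rho> z *\<^sub>R F (x - z))"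
  have c: "continuous_on UNIV \<rho>" using \<rho> by (rule smooth_on_continuous)
  have "\<exists>T. open T \<and> x0 \<in> T \<and> Ck_on n ?G T" for n x0
  proof (intro exI conjI)
    let ?a = "x0 - (e + 1) *\<^sub>R One" and ?b = "x0 + (e + 1) *\<^sub>R One"
    have "?G x = integral (cbox ?a ?b) (\<lambda>y. \<rho> (x - y) *\<^sub>R F y)" if "x \<in> ball x0 1" for x
    proof -
      let ?f = "\<lambda>y. \<rho> (x - y) *\<^sub>R F y"
      let ?S = "cbox (x - e *\<^sub>R One) (x + e *\<^sub>R One)"
      have "?f integrable_on ?S"
        by (intro integrable_continuous continuous_intros continuous_on_compose2[OF c]
              continuous_on_compose2[OF F]) auto
      then have 1: "(?f has_integral integral ?S ?f) ?S" by (rule integrable_integral)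
      have "((\<lambda>z. \<rho> z *\<^sub>R F (x - z)) has_integral integral ?S ?f) (centered_cube e)"
      proof -
        have "?S \<noteq> {}" using e by (simp add: box_ne_empty inner_simps)
        then have "(\<lambda>y. (1 / - 1) *\<^sub>R y + - ((1 / - 1) *\<^sub>R x)) ` ?S = centered_cube e"
          using image_affinity_cbox[of "-1" x "x - e *\<^sub>R One" "x + e *\<^sub>R One"] by simp
        with has_integral_affinity[OF 1, of "-1" x] show ?thesis by simp
      qed
      then have "?G x = integral ?S ?f" by (rule integral_unique)
      moreover have "(?f has_integral integral ?S ?f) (cbox ?a ?b)"
      proof (rule has_integral_on_superset[OF 1])
        fix y assume "y \<notin> ?S"
        have "x - y \<notin> centered_cube e"
        proof
          assume "x - y \<in> centered_cube e"
          then have "y \<in> ?S" by (force simp: mem_box algebra_simps)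
          with \<open>y \<notin> ?S\<close> show False by simp
        qed
        then have "e \<le> norm (x - y)" using ball_subset_centered_cube[of "x - y" e] by force
        then show "?f y = 0" by (simp add: supp)
      next
        have "\<bar>(x - x0) \<bullet> i\<bar> \<le> 1" if "i \<in> Basis" for i
          using Basis_le_norm[OF that, of "x - x0"] \<open>x \<in> ball x0 1\<close> by (simp add: dist_norm norm_minus_commute)
        then show "?S \<subseteq> cbox ?a ?b"
          by (intro subset_box_imp) (fastforce simp: abs_le_iff algebra_simps)
      qed
      ultimately show ?thesis by (simp add: integral_unique)
    qed
    then show "Ck_on n ?G (ball x0 1)"
      using Ck_on_cong[of "ball x0 1" ?G] smooth_on_subset[OF smooth_on_convolution[OF \<rho> F, of ?a ?b]]
      by (simp add: smooth_on_def)
  qed auto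
  then show ?thesis unfolding smooth_on_def by (intro allI Ck_on_local)
qed

text \<open>The smooth map \<open>G\<close> is an average of translates of \<open>F\<close> by vectors shorter than \<open>e\<close>, so it has the
  same Lipschitz constant, and \<open>G x\<close> lies in every closed half-space that contains all values of
  \<open>F\<close> near \<open>x\<close>. The half-space property contains all that is needed about the size of \<open>G\<close>: pointwise
  bounds, closeness to \<open>F\<close>, and the preservation of local constancy.\<close>

lemma lipschitz_smoothing:
  fixes F :: "'a::euclidean_space \<Rightarrow> 'b::euclidean_space"
  assumes L: "L-lipschitz_on UNIV F" and e: "0 < e"
  obtains G where "smooth_on G UNIV" "L-lipschitz_on UNIV G"
    "\<And>x v c. (\<And>y. dist x y < e \<Longrightarrow> F y \<bullet> v \<le> c) \<Longrightarrow> G x \<bullet> v \<le> c"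
proof -
  obtain \<rho> :: "'a \<Rightarrow> real" where \<rho>: "smooth_on \<rho> UNIV" "\<And>z. 0 \<le> \<rho> z" "\<And>z. e \<le> norm z \<Longrightarrow> \<rho> z = 0"
    "(\<rho> has_integral 1) (centered_cube e)"
    by (rule ex_mollifier[OF e]) (rule that)
  have F: "continuous_on UNIV F" using L by (rule lipschitz_on_continuous_on)
  have c: "continuous_on UNIV \<rho>" using \<rho>(1) by (rule smooth_on_continuous)
  let ?C = "centered_cube e :: 'a set"
  define G where "G x = integral ?C (\<lambda>z. \<rho> z *\<^sub>R F (x - z))" for x
  have int: "(\<lambda>z. \<rho> z *\<^sub>R F (x - z)) integrable_on ?C" for x
    by (intro integrable_continuous continuous_intros continuous_on_compose2[OF c]
              continuous_on_compose2[OF F]) auto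
  have "smooth_on G UNIV"
    using smooth_on_mollification[OF e \<rho>(1,3) F] by (simp add: G_def[abs_def])
  moreover have "L-lipschitz_on UNIV G"
  proof (rule lipschitz_onI)
    fix x y
    have "G x - G y = integral ?C (\<lambda>z. \<rho> z *\<^sub>R F (x - z) - \<rho> z *\<^sub>R F (y - z))"
      unfolding G_def by (rule integral_diff[OF int int, symmetric])
    also have "norm \<dots> \<le> integral ?C (\<lambda>z. \<rho> z * (L * dist x y))"
    proof (rule integral_norm_bound_integral)
      show "(\<lambda>z. \<rho> z *\<^sub>R F (x - z) - \<rho> z *\<^sub>R F (y - z)) integrable_on ?C"
        using integrable_diff[OF int int] .
      show "(\<lambda>z. \<rho> z * (L * dist x y)) integrable_on ?C"
        using has_integral_mult_left[OF \<rho>(4)] by (auto simp: integrable_on_def)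
      fix z
      have "norm (F (x - z) - F (y - z)) \<le> L * dist x y"
        using lipschitz_onD[OF L, of "x - z" "y - z"] by (simp add: dist_norm)
      then show "norm (\<rho> z *\<^sub>R F (x - z) - \<rho> z *\<^sub>R F (y - z)) \<le> \<rho> z * (L * dist x y)"
        using \<rho>(2)[of z] by (simp add: mult_left_mono flip: scaleR_diff_right)
    qed
    also have "\<dots> = L * dist x y"
      using integral_unique[OF has_integral_mult_left[OF \<rho>(4), of "L * dist x y"]]
      by (simp only: mult_1)
    finally show "dist (G x) (G y) \<le> L * dist x y" by (simp add: dist_norm)
  qed (rule lipschitz_on_nonneg[OF L])
  moreover have "G x \<bullet> v \<le> c" if le: "\<And>y. dist x y < e \<Longrightarrow> F y \<bullet> v \<le> c" for x v c
  proof -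
    have "((\<lambda>z. (\<rho> z *\<^sub>R F (x - z)) \<bullet> v) has_integral G x \<bullet> v) ?C"
      using has_integral_linear[OF integrable_integral[OF int] bounded_linear_inner_left]
      by (simp add: G_def o_def)
    moreover have "((\<lambda>z. \<rho> z * c) has_integral c) ?C"
      using has_integral_mult_left[OF \<rho>(4), of c] by simp
    moreover have "(\<rho> z *\<^sub>R F (x - z)) \<bullet> v \<le> \<rho> z * c" for z
    proof (cases "norm z < e")
      case True
      then have "F (x - z) \<bullet> v \<le> c" by (intro le) (simp add: dist_norm)
      then show ?thesis using \<rho>(2) by (simp add: mult_left_mono)
    qed (simp add: \<rho>(3))
    ultimately show ?thesis by (meson has_integral_le)
  qed
  ultimately show thesis using that by blast
qed

lemma lipschitz_smoothing_dist:
  fixes F :: "'a::euclidean_space \<Rightarrow> 'b::euclidean_space"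
  assumes L: "L-lipschitz_on UNIV F" and e: "0 < e"
  obtains G where "smooth_on G UNIV" "L-lipschitz_on UNIV G" "\<And>x. norm (G x - F x) \<le> L * e"
proof -
  obtain G where G: "smooth_on G UNIV" "L-lipschitz_on UNIV G"
    "\<And>x v c. (\<And>y. dist x y < e \<Longrightarrow> F y \<bullet> v \<le> c) \<Longrightarrow> G x \<bullet> v \<le> c"
    using lipschitz_smoothing[OF L e] by metis
  have L0: "0 \<le> L" using L by (rule lipschitz_on_nonneg)
  have "norm (G x - F x) \<le> L * e" for x
  proof (cases "G x = F x")
    case False
    let ?v = "G x - F x"
    have "G x \<bullet> ?v \<le> F x \<bullet> ?v + L * e * norm ?v"
    proof (rule G(3))
      fix y assume y: "dist x y < e"
      have "(F y - F x) \<bullet> ?v \<le> norm (F y - F x) * norm ?v" by (rule norm_cauchy_schwarz)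
      also have "\<dots> \<le> L * e * norm ?v"
      proof (rule mult_right_mono)
        have "norm (F y - F x) \<le> L * dist y x" using lipschitz_onD[OF L, of y x] by (simp add: dist_norm)
        also have "\<dots> \<le> L * e" using y L0 by (intro mult_left_mono) (auto simp: dist_commute)
        finally show "norm (F y - F x) \<le> L * e" .
      qed simp
      finally show "F y \<bullet> ?v \<le> F x \<bullet> ?v + L * e * norm ?v" by (simp add: inner_diff_left)
    qed
    moreover have "norm ?v * norm ?v = G x \<bullet> ?v - F x \<bullet> ?v"
      using power2_norm_eq_inner[of ?v] by (simp only: power2_eq_square inner_diff_left[of "G x" "F x"])
    ultimately have "norm ?v * norm ?v \<le> L * e * norm ?v" by linarith
    then show ?thesis using False by (simp add: mult_le_cancel_right)
  qed (use L0 e in simp)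
  then show thesis using that G(1,2) by blast
qed


section \<open>Smooth cutoff functions\<close>

text \<open>A piecewise linear function of the distance to \<open>S\<close>, going from \<open>1\<close> at distance \<open>d/3\<close> to \<open>0\<close> at
  distance \<open>2d/3\<close>, is mollified at scale \<open>d/4\<close>. The smoothed function is constant up to distance
  \<open>d/3 - d/4 = d/12\<close> and beyond distance \<open>2d/3 + d/4 = 11d/12\<close>.\<close>

lemma smooth_distance_cutoff:
  fixes S :: "'a::euclidean_space set"
  assumes "0 < d" "S \<noteq> {}"
  obtains \<theta> :: "'a \<Rightarrow> real" where "smooth_on \<theta> UNIV" "(3 / d)-lipschitz_on UNIV \<theta>"
    "\<And>x. 0 \<le> \<theta> x" "\<And>x. \<theta> x \<le> 1"
    "\<And>x. infdist x S < d / 12 \<Longrightarrow> \<theta> x = 1" "\<And>x. 11 * d / 12 < infdist x S \<Longrightarrow> \<theta> x = 0"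
proof -
  define \<Lambda> where "\<Lambda> x = max 0 (min 1 (2 - 3 / d * infdist x S))" for x
  have lip: "(3 / d)-lipschitz_on UNIV \<Lambda>"
  proof (rule lipschitz_onI)
    fix x y
    have "\<bar>\<Lambda> x - \<Lambda> y\<bar> \<le> \<bar>3 / d * infdist x S - 3 / d * infdist y S\<bar>"
      unfolding \<Lambda>_def by linarith
    also have "\<dots> = \<bar>3 / d * (infdist x S - infdist y S)\<bar>"
      by (simp only: right_diff_distrib)
    also have "\<dots> = 3 / d * \<bar>infdist x S - infdist y S\<bar>"
      using assms(1) by (simp only: abs_mult) simp
    also have "\<dots> \<le> 3 / d * dist x y"
      using assms(1) by (intro mult_left_mono infdist_triangle_abs) auto
    finally show "dist (\<Lambda> x) (\<Lambda> y) \<le> 3 / d * dist x y" by (simp add: dist_real_def)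
  qed (use assms in auto)
  have "0 < d / 4" using assms by simp
  from lipschitz_smoothing[OF lip this] obtain \<theta> where \<theta>: "smooth_on \<theta> UNIV" "(3 / d)-lipschitz_on UNIV \<theta>"
    "\<And>x v c. (\<And>y. dist x y < d / 4 \<Longrightarrow> \<Lambda> y \<bullet> v \<le> c) \<Longrightarrow> \<theta> x \<bullet> v \<le> c" by metis
  have ub: "\<theta> x \<le> c" if "\<And>y. dist x y < d / 4 \<Longrightarrow> \<Lambda> y \<le> c" for x c
    using \<theta>(3)[of x 1 c] that by simp
  have lb: "c \<le> \<theta> x" if "\<And>y. dist x y < d / 4 \<Longrightarrow> c \<le> \<Lambda> y" for x c
    using \<theta>(3)[of x "-1" "-c"] that by simp
  have rng: "0 \<le> \<Lambda> y" "\<Lambda> y \<le> 1" for y by (auto simp: \<Lambda>_def)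
  show thesis
  proof (rule that[OF \<theta>(1,2)])
    show "0 \<le> \<theta> x" "\<theta> x \<le> 1" for x using lb ub rng by blast+
    show "\<theta> x = 1" if "infdist x S < d / 12" for x
    proof (rule antisym[OF ub lb])
      fix y assume "dist x y < d / 4"
      then have "infdist y S < d / 3" using that infdist_triangle[of y S x] by (simp add: dist_commute)
      then have "3 / d * infdist y S < 1" using assms(1) by (simp add: field_simps)
      then show "1 \<le> \<Lambda> y" by (simp add: \<Lambda>_def)
    qed (rule rng)
    show "\<theta> x = 0" if "11 * d / 12 < infdist x S" for x
    proof (rule antisym[OF ub lb])
      fix y assume "dist x y < d / 4"
      then have "2 * d / 3 < infdist y S" using that infdist_triangle[of x S y] by simp
      then have "2 < 3 / d * infdist y S" using assms(1) by (simp add: field_simps)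
      then show "\<Lambda> y \<le> 0" by (simp add: \<Lambda>_def)
    qed (rule rng)
  qed
qed

lemma smooth_cutoff_compact:
  fixes S :: "'a::euclidean_space set"
  assumes "compact S" "open W" "S \<subseteq> W"
  obtains \<theta> :: "'a \<Rightarrow> real" and V C where "smooth_on \<theta> UNIV" "open V" "S \<subseteq> V" "V \<subseteq> W" 
    "\<And>x. x \<in> V \<Longrightarrow> \<theta> x = 1" "closed C" "C \<subseteq> W" "\<And>x. x \<notin> C \<Longrightarrow> \<theta> x = 0"
    "\<And>x. 0 \<le> \<theta> x" "\<And>x. \<theta> x \<le> 1"
proof (cases "S = {}")
  case True
  show thesis by (rule that[of "\<lambda>_. 0" "{}" "{}"]) (auto simp: True smooth_on_const)
next
  case False
  obtain d where d: "d > 0" "(\<Union>x\<in>S. ball x d) \<subseteq> W"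
    using compact_subset_open_imp_ball_epsilon_subset[OF assms] by blast
  obtain \<theta> :: "'a \<Rightarrow> real" where \<theta>: "smooth_on \<theta> UNIV" "(3 / d)-lipschitz_on UNIV \<theta>"
    "\<And>x. 0 \<le> \<theta> x" "\<And>x. \<theta> x \<le> 1"
    "\<And>x. infdist x S < d / 12 \<Longrightarrow> \<theta> x = 1" "\<And>x. 11 * d / 12 < infdist x S \<Longrightarrow> \<theta> x = 0"
    using smooth_distance_cutoff[OF d(1) False] by metis
  have W: "x \<in> W" if "infdist x S < d" for x
  proof -
    obtain y where "y \<in> S" "infdist x S = dist x y"
      using infdist_attains_inf[OF compact_imp_closed[OF assms(1)] False] by metis
    then have "x \<in> ball y d" using that by (simp add: dist_commute)
    then show ?thesis using d(2) \<open>y \<in> S\<close> by blast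
  qed
  show thesis
  proof (rule that[of \<theta> "{x. infdist x S < d / 12}" "{x. infdist x S \<le> 11 * d / 12}"])
    show "open {x. infdist x S < d / 12}"
      by (intro open_Collect_less continuous_intros)
    show "closed {x. infdist x S \<le> 11 * d / 12}"
      by (intro closed_Collect_le continuous_intros)
  qed (use \<theta> W d(1) in auto)
qed

lemma smooth_on_cutoff:
  assumes "smooth_on \<theta> UNIV" "open W" "closed C" "C \<subseteq> W" "\<And>x. x \<notin> C \<Longrightarrow> \<theta> x = 0" "smooth_on F W"
  shows "smooth_on (\<lambda>x. \<theta> x *\<^sub>R F x) UNIV"
proof -
  have "smooth_on (\<lambda>x. \<theta> x *\<^sub>R F x) W"
    by (rule smooth_on_scaleR[OF assms(2) smooth_on_subset[OF assms(1)] assms(6)]) simp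
  moreover have "smooth_on (\<lambda>x. \<theta> x *\<^sub>R F x) (- C)"
    using assms(3,5) by (subst smooth_on_cong[where g="\<lambda>_. 0"]) (auto simp: smooth_on_const)
  moreover have "W \<union> - C = UNIV" using assms(4) by blast
  ultimately show ?thesis using smooth_on_open_Un[OF assms(2), of "- C"] assms(3) by (metis open_Compl)
qed

section \<open>Kirszbraun's theorem\<close>

text \<open>The parallel axis theorem for the point masses \<open>w p\<close> at \<open>a p\<close>, in a form without division by the
  total mass.\<close>

lemma sum_weighted_distances:
  fixes a :: "'i \<Rightarrow> 'a::real_inner" and w :: "'i \<Rightarrow> real"
  shows "(\<Sum>p\<in>R. \<Sum>q\<in>R. w p * w q * (norm (a p - a q))\<^sup>2)
    = 2 * sum w R * (\<Sum>p\<in>R. w p * (norm (a p))\<^sup>2) - 2 * (norm (\<Sum>p\<in>R. w p *\<^sub>R a p))\<^sup>2"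
proof -
  have "(\<Sum>p\<in>R. \<Sum>q\<in>R. w p * w q * (norm (a p - a q))\<^sup>2)
    = (\<Sum>p\<in>R. \<Sum>q\<in>R. w q * (w p * (norm (a p))\<^sup>2)) + (\<Sum>p\<in>R. \<Sum>q\<in>R. w p * (w q * (norm (a q))\<^sup>2))
      - 2 * (\<Sum>p\<in>R. \<Sum>q\<in>R. (w p *\<^sub>R a p) \<bullet> (w q *\<^sub>R a q))"
    by (simp add: sum.distrib[symmetric] sum_subtractf[symmetric] sum_distrib_left
        power2_norm_eq_inner inner_diff_left inner_diff_right inner_commute algebra_simps)
  also have "(\<Sum>p\<in>R. \<Sum>q\<in>R. w q * (w p * (norm (a p))\<^sup>2)) = sum w R * (\<Sum>p\<in>R. w p * (norm (a p))\<^sup>2)"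
    by (simp add: sum_product mult.commute sum_distrib_left sum_distrib_right)
  also have "(\<Sum>p\<in>R. \<Sum>q\<in>R. w p * (w q * (norm (a q))\<^sup>2)) = sum w R * (\<Sum>p\<in>R. w p * (norm (a p))\<^sup>2)"
    by (simp add: sum_product)
  also have "(\<Sum>p\<in>R. \<Sum>q\<in>R. (w p *\<^sub>R a p) \<bullet> (w q *\<^sub>R a q)) = (norm (\<Sum>p\<in>R. w p *\<^sub>R a p))\<^sup>2"
    by (simp only: power2_norm_eq_inner inner_sum_left inner_sum_right) (rule sum.swap)
  finally show ?thesis by simp
qed

lemma square_positive_part_deriv:
  fixes s :: real
  shows "((\<lambda>s. (max 0 s)\<^sup>2) has_real_derivative 2 * max 0 s) (at s)"
proof -
  consider "s < 0" | "s = 0" | "s > 0" by linarith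
  then show ?thesis
  proof cases
    case 1
    have "((\<lambda>_. 0) has_real_derivative 0) (at s)" by simp
    moreover have "(0::real) = (max 0 t)\<^sup>2" if "t \<in> {..<0}" for t
      using that by simp
    ultimately show ?thesis
      using 1 by (elim has_field_derivative_transform_within_open[where S="{..<0}", THEN DERIV_cong]) auto
  next
    case 2
    have "((\<lambda>h::real. ((max 0 (0 + h))\<^sup>2 - (max 0 0)\<^sup>2) / h) \<longlongrightarrow> 0) (at 0)"
    proof (rule Lim_null_comparison)
      show "\<forall>\<^sub>F h in at 0. norm (((max 0 (0 + h))\<^sup>2 - (max 0 0)\<^sup>2) / h) \<le> \<bar>h::real\<bar>"
        by (rule always_eventually) (auto simp: max_def power2_eq_square)
      show "((\<lambda>h. \<bar>h\<bar>) \<longlongrightarrow> (0::real)) (at 0)"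
        by (auto intro!: tendsto_eq_intros)
    qed
    then show ?thesis using 2 by (simp add: DERIV_def)
  next
    case 3
    have "((\<lambda>s. s\<^sup>2) has_real_derivative 2 * s) (at s)"
      by (auto intro!: derivative_eq_intros)
    moreover have "t\<^sup>2 = (max 0 t)\<^sup>2" if "t \<in> {0<..}" for t :: real
      using that by simp
    ultimately show ?thesis
      using 3 by (elim has_field_derivative_transform_within_open[where S="{0<..}", THEN DERIV_cong]) auto
  qed
qed

text \<open>For \<open>p = (x\<^sub>p, y\<^sub>p)\<close> let \<open>u p z\<close> be the excess of \<open>|z - y\<^sub>p|\<^sup>2\<close> over its admissible size. The
  sum of the squares of the positive parts of the \<open>u p\<close> has a minimum \<open>z\<close>. There its derivative
  vanishes, which says that \<open>z\<close> is the barycentre of the \<open>y\<^sub>p\<close> for the weights \<open>w p = max 0 (u p z)\<close>. For a barycentre, the weighted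
  sum of the \<open>|z - y\<^sub>p|\<^sup>2\<close> is determined by the mutual distances of the \<open>y\<^sub>p\<close>, which are controlled by
  those of the \<open>x\<^sub>p\<close>; therefore the weighted sum of the excesses is at most \<open>0\<close>. But this sum is
  the sum of the squares of the weights, so all weights are zero.\<close>

lemma kirszbraun_finite:
  fixes R :: "('a::euclidean_space \<times> 'b::euclidean_space) set"
  assumes fin: "finite R" and ne: "R \<noteq> {}"
    and lip: "\<And>p q. p \<in> R \<Longrightarrow> q \<in> R \<Longrightarrow> norm (snd p - snd q) \<le> k * norm (fst p - fst q)"
  shows "\<exists>z. \<forall>p\<in>R. (norm (z - snd p))\<^sup>2 \<le> (k * norm (x - fst p))\<^sup>2"
proof -
  define u where "u p z = (norm (z - snd p))\<^sup>2 - (k * norm (x - fst p))\<^sup>2" for p :: "'a \<times> 'b" and z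
  define \<Psi> where "\<Psi> z = (\<Sum>p\<in>R. (max 0 (u p z))\<^sup>2)" for z
  have cont: "continuous_on A \<Psi>" for A
    unfolding \<Psi>_def u_def by (intro continuous_intros)
  have \<Psi>_ge: "(max 0 (u p z))\<^sup>2 \<le> \<Psi> z" if "p \<in> R" for p z
    unfolding \<Psi>_def by (rule member_le_sum[OF that]) (auto simp: fin)
  have \<Psi>_nonneg: "0 \<le> \<Psi> z" for z unfolding \<Psi>_def by (intro sum_nonneg) auto
  obtain p0 where p0: "p0 \<in> R" using ne by blast
  \<comment> \<open>Outside this ball the single term of \<open>p0\<close> exceeds the value of \<open>\<Psi>\<close> at the centre, so that a
  minimum over the ball is a global one.\<close>
  define r where "r = sqrt ((k * norm (x - fst p0))\<^sup>2 + (1 + \<Psi> (snd p0)))"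
  have r: "0 \<le> r" "r\<^sup>2 = (k * norm (x - fst p0))\<^sup>2 + (1 + \<Psi> (snd p0))"
    using \<Psi>_nonneg[of "snd p0"] by (auto simp: r_def)
  have "\<exists>z\<in>cball (snd p0) r. \<forall>y\<in>cball (snd p0) r. \<Psi> z \<le> \<Psi> y"
    using continuous_attains_inf[OF compact_cball _ cont, of "snd p0" r] r(1) by auto
  then obtain z where z: "\<And>y. y \<in> cball (snd p0) r \<Longrightarrow> \<Psi> z \<le> \<Psi> y"
    by blast
  have min: "\<Psi> z \<le> \<Psi> y" for y
  proof (cases "y \<in> cball (snd p0) r")
    case False
    then have "r < norm (y - snd p0)" by (simp add: dist_norm norm_minus_commute)
    then have "r\<^sup>2 \<le> (norm (y - snd p0))\<^sup>2" using r(1) by (intro power_mono) auto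
    then have "1 + \<Psi> (snd p0) \<le> u p0 y" using r(2) by (simp add: u_def)
    then have "(1 + \<Psi> (snd p0))\<^sup>2 \<le> (max 0 (u p0 y))\<^sup>2"
      using \<Psi>_nonneg[of "snd p0"] by (intro power_mono) auto
    moreover have "\<Psi> (snd p0) \<le> (1 + \<Psi> (snd p0))\<^sup>2"
      using \<Psi>_nonneg[of "snd p0"] by (simp add: power2_eq_square algebra_simps)
    moreover have "\<Psi> z \<le> \<Psi> (snd p0)" using z[of "snd p0"] r(1) by simp
    ultimately show ?thesis using \<Psi>_ge[OF p0, of y] by linarith
  qed (use z in blast)
  define w where "w p = max 0 (u p z)" for p
  have w: "0 \<le> w p" for p by (simp add: w_def)
  have "(\<Psi> has_derivative (\<lambda>h. \<Sum>p\<in>R. (2 * w p) * (2 * ((z - snd p) \<bullet> h)))) (at z)"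
    unfolding \<Psi>_def
  proof (rule has_derivative_sum)
    fix p
    have "(u p has_derivative (\<lambda>h. 2 * ((z - snd p) \<bullet> h))) (at z)"
      unfolding u_def power2_norm_eq_inner
      by (auto intro!: derivative_eq_intros simp: inner_commute)
    from has_derivative_compose[OF this has_field_derivative_imp_has_derivative[OF square_positive_part_deriv]]
    show "((\<lambda>z. (max 0 (u p z))\<^sup>2) has_derivative (\<lambda>h. (2 * w p) * (2 * ((z - snd p) \<bullet> h)))) (at z)"
      by (simp add: w_def)
  qed
  from differential_zero_maxmin[OF _ _ this, of UNIV] min
  have "(\<lambda>h. \<Sum>p\<in>R. (2 * w p) * (2 * ((z - snd p) \<bullet> h))) = (\<lambda>h. 0)"
    by auto
  from fun_cong[OF this]
  have stationary: "(\<Sum>p\<in>R. (2 * w p) * (2 * ((z - snd p) \<bullet> h))) = 0" for h .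
  have "(\<Sum>p\<in>R. (2 * w p) * (2 * ((z - snd p) \<bullet> h))) = 4 * ((\<Sum>p\<in>R. w p *\<^sub>R (z - snd p)) \<bullet> h)" for h
    by (simp add: inner_sum_left sum_distrib_left mult.assoc)
  from trans[OF sym[OF this] stationary]
  have "4 * ((\<Sum>p\<in>R. w p *\<^sub>R (z - snd p)) \<bullet> (\<Sum>p\<in>R. w p *\<^sub>R (z - snd p))) = 0"
    .
  then have bary: "(\<Sum>p\<in>R. w p *\<^sub>R (z - snd p)) = 0"
    by (simp only: mult_eq_0_iff inner_eq_zero_iff) (erule disjE, simp, assumption)
  have "2 * sum w R * (\<Sum>p\<in>R. w p * (norm (z - snd p))\<^sup>2)
      = (\<Sum>p\<in>R. \<Sum>q\<in>R. w p * w q * (norm ((z - snd p) - (z - snd q)))\<^sup>2)"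
    by (simp only: sum_weighted_distances bary) simp
  also have "\<dots> \<le> (\<Sum>p\<in>R. \<Sum>q\<in>R. w p * w q * (k\<^sup>2 * (norm ((x - fst p) - (x - fst q)))\<^sup>2))"
  proof (intro sum_mono mult_left_mono)
    fix p q assume "p \<in> R" "q \<in> R"
    then have "norm (snd q - snd p) \<le> k * norm (fst q - fst p)" by (intro lip)
    then show "(norm ((z - snd p) - (z - snd q)))\<^sup>2 \<le> k\<^sup>2 * (norm ((x - fst p) - (x - fst q)))\<^sup>2"
      by (simp add: power_mono flip: power_mult_distrib)
  qed (simp add: w)
  also have "\<dots> = k\<^sup>2 * (\<Sum>p\<in>R. \<Sum>q\<in>R. w p * w q * (norm ((x - fst p) - (x - fst q)))\<^sup>2)"
    by (simp add: sum_distrib_left mult.left_commute)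
  also have "\<dots> \<le> k\<^sup>2 * (2 * sum w R * (\<Sum>p\<in>R. w p * (norm (x - fst p))\<^sup>2))"
    unfolding sum_weighted_distances by (intro mult_left_mono) auto
  finally have "sum w R * (\<Sum>p\<in>R. w p * (norm (z - snd p))\<^sup>2) \<le> sum w R * (k\<^sup>2 * (\<Sum>p\<in>R. w p * (norm (x - fst p))\<^sup>2))"
    by (simp add: algebra_simps)
  then have "sum w R * (\<Sum>p\<in>R. w p * u p z) \<le> 0"
    by (simp add: u_def right_diff_distrib sum_subtractf sum_distrib_left power_mult_distrib mult.left_commute)
  moreover have "w p * u p z = (w p)\<^sup>2" for p by (simp add: w_def max_def power2_eq_square)
  ultimately have le: "sum w R * (\<Sum>p\<in>R. (w p)\<^sup>2) \<le> 0" by simp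
  have "w p = 0" if "p \<in> R" for p
  proof (rule ccontr)
    assume "w p \<noteq> 0"
    then have "0 < w p" using w[of p] by simp
    then have "0 < sum w R" "0 < (\<Sum>p\<in>R. (w p)\<^sup>2)"
      using that fin w by (auto intro!: sum_pos2[of R p])
    with le show False by (simp add: mult_le_0_iff)
  qed
  then have "\<forall>p\<in>R. u p z \<le> 0" unfolding w_def by (metis max.cobounded2)
  then show ?thesis unfolding u_def by auto
qed

text \<open>The admissible values at \<open>x\<close> form an intersection of closed balls. Every finite subfamily has a
  common point, hence by compactness so does the whole family.\<close>

lemma kirszbraun_one_point:
  fixes R :: "('a::euclidean_space \<times> 'b::euclidean_space) set"
  assumes k: "0 \<le> k"
    and lip: "\<And>p q. p \<in> R \<Longrightarrow> q \<in> R \<Longrightarrow> norm (snd p - snd q) \<le> k * norm (fst p - fst q)"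
  shows "\<exists>z. \<forall>p\<in>R. norm (z - snd p) \<le> k * norm (x - fst p)"
proof (cases "R = {}")
  case False
  then obtain p0 where p0: "p0 \<in> R" by blast
  define B where "B p = cball (snd p) (k * norm (x - fst p))" for p :: "'a \<times> 'b"
  have fin: "\<exists>z. \<forall>p\<in>R'. z \<in> B p" if R': "finite R'" "R' \<subseteq> R" "R' \<noteq> {}" for R'
  proof -
    obtain z where "\<forall>p\<in>R'. (norm (z - snd p))\<^sup>2 \<le> (k * norm (x - fst p))\<^sup>2"
      using kirszbraun_finite[OF R'(1,3), of k x] lip R' by (meson subsetD)
    then have "\<forall>p\<in>R'. norm (z - snd p) \<le> k * norm (x - fst p)"
      using k by (auto intro: power2_le_imp_le)
    then show ?thesis by (auto simp: B_def dist_norm norm_minus_commute)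
  qed
  have "B p0 \<inter> \<Inter>(B ` R) \<noteq> {}"
  proof (rule compact_imp_fip)
    fix F' assume "finite F'" "F' \<subseteq> B ` R"
    then obtain R' where "finite R'" "R' \<subseteq> R" "F' = B ` R'" by (meson finite_subset_image)
    then show "B p0 \<inter> \<Inter>F' \<noteq> {}" using fin[of "insert p0 R'"] p0 by auto
  qed (auto simp: B_def)
  then obtain z where "\<forall>p\<in>R. z \<in> B p" by blast
  then show ?thesis by (auto simp: B_def dist_norm norm_minus_commute)
qed simp

text \<open>Zorn's lemma for sets of pairs on which the Lipschitz inequality holds: a maximal one containing
  the graph of \<open>f\<close> is the graph of a function on the whole space, since otherwise a point could be
  added.\<close>

theorem kirszbraun:
  fixes f :: "'a::euclidean_space \<Rightarrow> 'b::euclidean_space"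
  assumes lip: "k-lipschitz_on S f"
  obtains F where "k-lipschitz_on UNIV F" "\<And>x. x \<in> S \<Longrightarrow> F x = f x"
proof -
  define A :: "('a \<times> 'b) set set" where "A = {R. (\<lambda>x. (x, f x)) ` S \<subseteq> R \<and>
    (\<forall>p\<in>R. \<forall>q\<in>R. norm (snd p - snd q) \<le> k * norm (fst p - fst q))}"
  have k: "0 \<le> k" using lip by (rule lipschitz_on_nonneg)
  have "(\<lambda>x. (x, f x)) ` S \<in> A"
    using lipschitz_onD[OF lip] by (auto simp: A_def dist_norm)
  then have "A \<noteq> {}" by blast
  moreover have "\<Union>C \<in> A" if "C \<noteq> {}" "subset.chain A C" for C
  proof -
    have "norm (snd p - snd q) \<le> k * norm (fst p - fst q)" if pq: "p \<in> \<Union>C" "q \<in> \<Union>C" for p q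
    proof -
      obtain X Y where "X \<in> C" "Y \<in> C" "p \<in> X" "q \<in> Y" using pq by blast
      with \<open>subset.chain A C\<close> obtain Z where "Z \<in> C" "p \<in> Z" "q \<in> Z"
        unfolding subset_chain_def by blast
      then show ?thesis using \<open>subset.chain A C\<close> unfolding subset_chain_def A_def by blast
    qed
    then show ?thesis using that unfolding A_def subset_chain_def by blast
  qed
  ultimately obtain M where M: "M \<in> A" "\<And>X. X \<in> A \<Longrightarrow> M \<subseteq> X \<Longrightarrow> X = M"
    using subset_Zorn_nonempty[of A] by blast
  have lipM: "\<And>p q. p \<in> M \<Longrightarrow> q \<in> M \<Longrightarrow> norm (snd p - snd q) \<le> k * norm (fst p - fst q)"
    using M(1) by (auto simp: A_def)
  have total: "\<exists>y. (x, y) \<in> M" for x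
  proof -
    obtain z where z: "\<forall>p\<in>M. norm (z - snd p) \<le> k * norm (x - fst p)"
      using kirszbraun_one_point[OF k lipM] by blast
    then have "insert (x, z) M \<in> A"
      using M(1) by (auto simp: A_def norm_minus_commute)
    then have "insert (x, z) M = M" using M(2) by blast
    then show ?thesis by blast
  qed
  define F where "F x = (SOME y. (x, y) \<in> M)" for x
  have F: "(x, F x) \<in> M" for x using total[of x] unfolding F_def by (rule someI_ex)
  have "k-lipschitz_on UNIV F"
    using lipM[OF F F] k by (auto intro!: lipschitz_onI simp: dist_norm)
  moreover have "F x = f x" if "x \<in> S" for x
  proof -
    have "(x, f x) \<in> M" using M(1) that by (auto simp: A_def)
    from lipM[OF F[of x] this] show ?thesis by simp
  qed
  ultimately show thesis using that by blast
qed


section \<open>Derivative bounds and Lipschitz constants\<close>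

lemma vector_derivative_quotient:
  assumes "(f has_vector_derivative a) (at t)"
  shows "((\<lambda>s. (f s - f t) /\<^sub>R (s - t)) \<longlongrightarrow> a) (at t)"
proof -
  have "((\<lambda>s. norm ((f s - f t) - (s - t) *\<^sub>R a) / norm (s - t)) \<longlongrightarrow> 0) (at t)"
    using assms by (simp add: has_vector_derivative_def has_derivative_iff_norm)
  moreover have "\<forall>\<^sub>F s in at t. norm ((f s - f t) - (s - t) *\<^sub>R a) / norm (s - t) = norm ((f s - f t) /\<^sub>R (s - t) - a)"
  proof (rule eventually_at_filter[THEN iffD2, OF always_eventually], intro allI impI)
    fix s assume "s \<noteq> t"
    then have "(f s - f t) /\<^sub>R (s - t) - a = ((f s - f t) - (s - t) *\<^sub>R a) /\<^sub>R (s - t)"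
      by (simp add: scaleR_diff_right)
    then show "norm ((f s - f t) - (s - t) *\<^sub>R a) / norm (s - t) = norm ((f s - f t) /\<^sub>R (s - t) - a)"
      by (simp add: divide_inverse mult.commute)
  qed
  ultimately have "((\<lambda>s. norm ((f s - f t) /\<^sub>R (s - t) - a)) \<longlongrightarrow> 0) (at t)"
    by (rule Lim_transform_eventually)
  then show ?thesis by (simp add: LIM_zero_iff tendsto_norm_zero_iff)
qed

text \<open>Divide by \<open>s - t\<close> and let \<open>s\<close> tend to \<open>t\<close>.\<close>

lemma vector_derivative_norm_le:
  assumes f: "(f has_vector_derivative a) (at t)" and g: "(g has_vector_derivative b) (at t)"
    and le: "\<forall>\<^sub>F s in at t. norm (f s - f t) \<le> k * norm (g s - g t)"
  shows "norm a \<le> k * norm b"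
proof (rule tendsto_le)
  show "((\<lambda>s. k * norm ((g s - g t) /\<^sub>R (s - t))) \<longlongrightarrow> k * norm b) (at t)"
    by (intro tendsto_intros vector_derivative_quotient g)
  show "((\<lambda>s. norm ((f s - f t) /\<^sub>R (s - t))) \<longlongrightarrow> norm a) (at t)"
    by (intro tendsto_intros vector_derivative_quotient f)
  show "\<forall>\<^sub>F s in at t. norm ((f s - f t) /\<^sub>R (s - t)) \<le> k * norm ((g s - g t) /\<^sub>R (s - t))"
    using le
  proof eventually_elim
    case (elim s)
    from mult_left_mono[OF this, of "inverse \<bar>s - t\<bar>"] show ?case by (simp add: mult.left_commute)
  qed
qed simp

lemma lipschitz_imp_derivative_bound:
  assumes "L-lipschitz_on UNIV f" "(f has_derivative D) (at x)"
  shows "norm (D v) \<le> L * norm v"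
proof (rule vector_derivative_norm_le)
  have line: "((\<lambda>s. x + s *\<^sub>R v) has_vector_derivative v) (at 0)"
    by (auto intro!: derivative_eq_intros simp: has_vector_derivative_def)
  show "((\<lambda>s. f (x + s *\<^sub>R v)) has_vector_derivative D v) (at 0)"
    using vector_derivative_diff_chain_within[OF line, of f D] assms(2)
    by (simp add: o_def has_derivative_at_withinI)
  show "((\<lambda>s. s *\<^sub>R v) has_vector_derivative v) (at 0)"
    by (auto intro!: derivative_eq_intros simp: has_vector_derivative_def)
  show "\<forall>\<^sub>F s in at 0. norm (f (x + s *\<^sub>R v) - f (x + 0 *\<^sub>R v)) \<le> L * norm (s *\<^sub>R v - 0 *\<^sub>R v)"
    using lipschitz_onD[OF assms(1), of "x + s *\<^sub>R v" x for s] by (auto simp: dist_norm)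
qed

lemma derivative_bound_imp_lipschitz:
  fixes f :: "'a::real_normed_vector \<Rightarrow> 'b::real_normed_vector"
  assumes "convex S" "0 \<le> L"
    and "\<And>x. x \<in> S \<Longrightarrow> (f has_derivative D x) (at x)" "\<And>x v. x \<in> S \<Longrightarrow> norm (D x v) \<le> L * norm v"
  shows "L-lipschitz_on S f"
proof (rule lipschitz_onI)
  fix x y assume "x \<in> S" "y \<in> S"
  then have "norm (f x - f y) \<le> L * norm (x - y)"
    using assms by (intro differentiable_bound[OF assms(1)])
      (auto intro: has_derivative_at_withinI onorm_bound)
  then show "dist (f x) (f y) \<le> L * dist x y" by (simp add: dist_norm)
qed fact

text \<open>It is enough to control the partial derivatives, which are continuous. The function \<open>\<omega>\<close> measures
  their total deviation and bounds the operator norm of the difference.\<close>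

lemma derivative_close:
  fixes F :: "'a::euclidean_space \<Rightarrow> 'b::euclidean_space"
  assumes F: "smooth_on F UNIV" and e: "0 < e"
  shows "\<exists>d>0. \<forall>y\<in>ball x d. \<forall>v. norm (frechet_derivative F (at y) v - frechet_derivative F (at x) v) \<le> e * norm v"
proof -
  let ?D = "\<lambda>y. frechet_derivative F (at y)"
  define \<omega> where "\<omega> y = (\<Sum>b\<in>Basis. norm (?D y b - ?D x b))" for y
  have "continuous_on UNIV \<omega>"
    unfolding \<omega>_def by (intro continuous_intros smooth_on_continuous[OF smooth_on_deriv[OF F]])
  then have "isCont \<omega> x" by (simp add: continuous_on_eq_continuous_at)
  then obtain d where d: "0 < d" "\<And>y. dist y x < d \<Longrightarrow> dist (\<omega> y) (\<omega> x) < e"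
    using e unfolding continuous_at_eps_delta by metis
  have "norm (?D y v - ?D x v) \<le> e * norm v" if "y \<in> ball x d" for y v
  proof -
    have lin: "linear (?D z)" for z
      using has_derivative_linear[OF smooth_onD[OF F UNIV_I]] .
    have "linear (\<lambda>v. ?D y v - ?D x v)" by (intro linear_compose_sub lin)
    then have "?D y v - ?D x v = (\<Sum>b\<in>Basis. (v \<bullet> b) *\<^sub>R (?D y b - ?D x b))"
      using linear_sum[of "\<lambda>v. ?D y v - ?D x v" "\<lambda>b. (v \<bullet> b) *\<^sub>R b" Basis]
      by (simp only: euclidean_representation linear_scale[OF lin] scaleR_diff_right)
    also have "norm \<dots> \<le> (\<Sum>b\<in>Basis. norm v * norm (?D y b - ?D x b))"
      by (intro sum_norm_le) (auto intro!: mult_right_mono Basis_le_norm)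
    also have "\<dots> = \<omega> y * norm v" by (simp only: \<omega>_def sum_distrib_left mult.commute)
    also have "\<dots> \<le> e * norm v"
    proof (rule mult_right_mono)
      have "dist (\<omega> y) (\<omega> x) < e" using that by (intro d(2)) (simp add: dist_commute)
      moreover have "\<omega> x = 0" by (simp add: \<omega>_def)
      ultimately show "\<omega> y \<le> e" by (simp add: dist_real_def)
    qed simp
    finally show ?thesis .
  qed
  then show ?thesis using d(1) by blast
qed

lemma derivative_bound_near_compact:
  fixes F :: "'a::euclidean_space \<Rightarrow> 'b::euclidean_space"
  assumes F: "smooth_on F UNIV" and T: "compact T" and k: "k < k'"
    and bound: "\<And>x v. x \<in> T \<Longrightarrow> norm (frechet_derivative F (at x) v) \<le> k * norm v"
  obtains d where "0 < d" "\<And>x y v. x \<in> T \<Longrightarrow> y \<in> ball x d \<Longrightarrow> norm (frechet_derivative F (at y) v) \<le> k' * norm v"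
proof -
  let ?D = "\<lambda>y. frechet_derivative F (at y)"
  have "\<forall>x. \<exists>d>0. \<forall>y\<in>ball x d. \<forall>v. norm (?D y v - ?D x v) \<le> (k' - k) * norm v"
    using derivative_close[OF F] k by simp
  then obtain r where r: "\<And>x. 0 < r x" "\<And>x y v. y \<in> ball x (r x) \<Longrightarrow> norm (?D y v - ?D x v) \<le> (k' - k) * norm v"
    by metis
  have "open (\<Union>x\<in>T. ball x (r x))" by auto
  moreover have "T \<subseteq> (\<Union>x\<in>T. ball x (r x))" using r(1) by auto
  ultimately obtain d where d: "0 < d" "(\<Union>x\<in>T. ball x d) \<subseteq> (\<Union>x\<in>T. ball x (r x))"
    using compact_subset_open_imp_ball_epsilon_subset[OF T] by blast
  show thesis
  proof (rule that[OF d(1)])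
    fix x y v assume "x \<in> T" "y \<in> ball x d"
    then obtain z where z: "z \<in> T" "y \<in> ball z (r z)" using d(2) by blast
    have "norm (?D y v) \<le> norm (?D z v) + norm (?D y v - ?D z v)"
      using norm_triangle_ineq[of "?D z v" "?D y v - ?D z v"] by simp
    also have "\<dots> \<le> k * norm v + (k' - k) * norm v"
      by (rule add_mono[OF bound[OF z(1)] r(2)[OF z(2)]])
    finally show "norm (?D y v) \<le> k' * norm v" by (simp add: algebra_simps)
  qed
qed


section \<open>Local smooth extension along a projected curve\<close>

lemma Ck_on_inverse:
  fixes g :: "'a::euclidean_space \<Rightarrow> real"
  assumes S: "open S" and g: "Ck_on n g S" and nz: "\<And>x. x \<in> S \<Longrightarrow> g x \<noteq> 0"
  shows "Ck_on n (\<lambda>x. inverse (g x)) S"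
proof -
  have "Ck_on n inverse (- {0::real})"
  proof (induction n)
    case 0
    show ?case by (simp add: continuous_on_inverse)
  next
    case (Suc n)
    show ?case
    proof (rule Ck_on_SucI)
      show "(inverse has_derivative (\<lambda>h. - (inverse x * h * inverse x))) (at x)" if "x \<in> - {0::real}" for x
        using that by (auto intro: has_derivative_inverse')
      have "Ck_on n (\<lambda>x. (- v) *\<^sub>R (inverse x * inverse x)) (- {0::real})" for v
        by (intro Ck_on_bilinear[OF bounded_bilinear_scaleR] Ck_on_bilinear[OF bounded_bilinear_mult]
            Ck_on_const Suc.IH) auto
      then show "Ck_on n (\<lambda>x. - (inverse x * v * inverse x)) (- {0::real})" for v
        by (simp add: mult.commute mult.left_commute)
    qed auto
  qed
  moreover have "g ` S \<subseteq> - {0}" using nz by auto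
  ultimately show ?thesis by (intro Ck_on_compose[OF S _ _ _ g]) auto
qed

text \<open>The derivative of the inverse \<open>\<tau>\<close> is \<open>1/f'\<close> composed with \<open>\<tau>\<close>, so each order of differentiability
  of \<open>\<tau>\<close> yields the next one.\<close>

lemma smooth_inverse_interval:
  fixes f :: "real \<Rightarrow> real"
  assumes S: "S = {a<..<b}" and f: "smooth_on f S"
    and der: "\<And>t. t \<in> S \<Longrightarrow> (f has_real_derivative f' t) (at t)" and pos: "\<And>t. t \<in> S \<Longrightarrow> 0 < f' t"
  obtains \<tau> where "open (f ` S)" "smooth_on \<tau> (f ` S)" "\<And>t. t \<in> S \<Longrightarrow> \<tau> (f t) = t"
    "\<And>t. t \<in> S \<Longrightarrow> (\<tau> has_real_derivative inverse (f' t)) (at (f t))"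
proof -
  have mono: "f s < f t" if "s \<in> S" "t \<in> S" "s < t" for s t
  proof (rule DERIV_pos_imp_increasing[OF that(3)])
    fix x assume "s \<le> x" "x \<le> t"
    then have "x \<in> S" using that S by auto
    then show "\<exists>y. (f has_real_derivative y) (at x) \<and> 0 < y" using der pos by blast
  qed
  then have inj: "inj_on f S"
    by (intro linorder_inj_onI) (force, simp add: linear)
  have oS: "open S" using S by simp
  have cont: "continuous_on S f" using f by (rule smooth_on_continuous)
  define \<tau> where "\<tau> = inv_into S f"
  have \<tau>: "\<tau> (f t) = t" if "t \<in> S" for t using inj that by (simp add: \<tau>_def)
  have oJ: "open (f ` S)" using invariance_of_domain[OF cont oS inj] .
  have der\<tau>: "(\<tau> has_real_derivative inverse (f' t)) (at (f t))" if t: "t \<in> S" for t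
  proof -
    have "(\<tau> has_derivative (*) (inverse (f' t))) (at (f t))"
    proof (rule has_derivative_inverse_strong[OF oS t cont \<tau>])
      show "(f has_derivative (*) (f' t)) (at t)"
        using der[OF t] by (simp add: has_field_derivative_def)
      show "(*) (f' t) \<circ> (*) (inverse (f' t)) = id"
        using pos[OF t] by (auto simp: o_def)
    qed
    then show ?thesis by (simp add: has_field_derivative_def)
  qed
  have f': "Ck_on n f' S" for n
  proof -
    have "frechet_derivative f (at t) 1 = f' t" if "t \<in> S" for t
      using frechet_derivative_at[OF has_field_derivative_imp_has_derivative[OF der[OF that]]]
      by (metis mult_1_right)
    then show ?thesis
      using smooth_on_deriv[OF f, of 1] Ck_on_cong[OF oS, of "\<lambda>t. frechet_derivative f (at t) 1" f']
      by (simp add: smooth_on_def)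
  qed
  have "Ck_on n \<tau> (f ` S)" for n
  proof (induction n)
    case 0
    have "isCont \<tau> y" if "y \<in> f ` S" for y using that der\<tau> DERIV_isCont by blast
    then show ?case by (simp add: continuous_at_imp_continuous_on)
  next
    case (Suc n)
    show ?case
    proof (rule Ck_on_SucI[OF oJ])
      show "(\<tau> has_derivative (\<lambda>v. v *\<^sub>R inverse (f' (\<tau> y)))) (at y)" if "y \<in> f ` S" for y
        using that der\<tau> \<tau> by (auto simp: has_field_derivative_def mult_commute_abs)
      have "\<tau> ` f ` S \<subseteq> S" using \<tau> by auto
      moreover have "f' t \<noteq> 0" if "t \<in> S" for t using pos[OF that] by simp
      ultimately have "Ck_on n (\<lambda>y. inverse (f' (\<tau> y))) (f ` S)"
        by (intro Ck_on_compose[OF oJ oS _ Ck_on_inverse[OF oS f'] Suc.IH])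
      then show "Ck_on n (\<lambda>y. v *\<^sub>R inverse (f' (\<tau> y))) (f ` S)" for v
        by (rule Ck_on_bilinear[OF bounded_bilinear_scaleR oJ Ck_on_const])
    qed
  qed
  then show thesis using that[OF oJ _ \<tau> der\<tau>] by (simp add: smooth_on_def)
qed

lemma smooth_on_vector_derivative:
  fixes c :: "real \<Rightarrow> 'a::euclidean_space"
  assumes "smooth_on c S" "t \<in> S"
  shows "(c has_vector_derivative frechet_derivative c (at t) 1) (at t)"
proof -
  let ?D = "frechet_derivative c (at t)"
  have D: "(c has_derivative ?D) (at t)" using smooth_onD[OF assms] .
  have "?D h = h *\<^sub>R ?D 1" for h
    using linear_scale[OF has_derivative_linear[OF D], of h 1]
    by (simp only: real_scaleR_def mult_1_right)
  then show ?thesis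
    unfolding has_vector_derivative_def by (intro has_derivative_eq_rhs[OF D] ext)
qed

text \<open>The curve is the inverse chart restricted to the line in which the flattened submanifold lies.
  The last property says that the curve exhausts \<open>K\<close> near \<open>p\<close>; it holds because the chart is
  continuous and maps \<open>K\<close> into that line.\<close>

lemma submanifold_local_curve:
  fixes K :: "'c::euclidean_space set"
  assumes "smooth_submanifold 1 K" "p \<in> K"
  obtains c :: "real \<Rightarrow> 'c" and d where "0 < d" "smooth_on c {-d<..<d}" "c 0 = p"
    "\<And>t. t \<in> {-d<..<d} \<Longrightarrow> c t \<in> K" "frechet_derivative c (at 0) 1 \<noteq> 0"
    "\<And>r. 0 < r \<Longrightarrow> \<exists>\<eta>>0. \<forall>M\<in>K. norm (M - p) < \<eta> \<longrightarrow> (\<exists>t\<in>{-r<..<r}. M = c t)"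
proof -
  obtain U V :: "'c set" and \<phi> \<psi> E where ch: "open U" "p \<in> U" "open V" "homeomorphism U V \<phi> \<psi>"
    "smooth_on \<phi> U" "smooth_on \<psi> V" "subspace E" "dim E = 1" "\<phi> ` (U \<inter> K) = V \<inter> E"
    using assms unfolding smooth_submanifold_def by metis
  obtain B where B: "B \<subseteq> E" "independent B" "E \<subseteq> span B" "card B = dim E"
    using basis_exists by blast
  then obtain e0 where "B = {e0}" using ch(8) by (metis card_1_singletonE)
  then have e0: "e0 \<noteq> 0" "E = span {e0}"
    using B dependent_zero ch(7) span_minimal[of B E] by blast+
  have spanE: "v \<in> E \<longleftrightarrow> (\<exists>t. v = t *\<^sub>R e0)" for v
    unfolding e0(2) span_singleton by auto
  define q where "q = \<phi> p"
  have qV: "q \<in> V" "q \<in> E" using ch(2,9) assms(2) by (auto simp: q_def)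
  obtain r where r: "0 < r" "ball q r \<subseteq> V" using ch(3) qV(1) open_contains_ball by blast
  define d where "d = r / norm e0"
  have d: "0 < d" "d * norm e0 = r" using r(1) e0(1) by (auto simp: d_def)
  let ?I = "{-d<..<d}"
  define l where "l t = q + t *\<^sub>R e0" for t
  define c where "c t = \<psi> (l t)" for t
  have lV: "l t \<in> V" if "t \<in> ?I" for t
  proof -
    have "\<bar>t\<bar> * norm e0 < d * norm e0" using that e0(1) by (intro mult_strict_right_mono) auto
    then have "l t \<in> ball q r" using d(2) by (simp add: dist_norm l_def)
    then show ?thesis using r(2) by blast
  qed
  have lE: "l t \<in> E" for t
    unfolding l_def using spanE by (intro subspace_add[OF ch(7) qV(2)]) blast
  have cK: "c t \<in> K \<inter> U" if t: "t \<in> ?I" for t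
  proof -
    have "l t \<in> \<phi> ` (U \<inter> K)" using lV[OF t] lE ch(9) by blast
    then obtain M where "M \<in> U" "M \<in> K" "l t = \<phi> M" by blast
    then show ?thesis using homeomorphism_apply1[OF ch(4)] by (simp add: c_def)
  qed
  have lin_l: "(l has_vector_derivative e0) (at t)" for t
    unfolding l_def by (auto intro!: derivative_eq_intros simp: has_vector_derivative_def)
  have "smooth_on l ?I"
    unfolding l_def
    by (intro smooth_on_add smooth_on_const smooth_on_scaleR smooth_on_linear bounded_linear_ident) auto
  then have smc: "smooth_on c ?I"
    unfolding c_def using lV by (intro smooth_on_compose[OF _ ch(3) _ ch(6)]) auto
  have c0: "c 0 = p" using homeomorphism_apply1[OF ch(4,2)] by (simp add: c_def l_def q_def)
  have "(c has_vector_derivative frechet_derivative c (at 0) 1) (at 0)"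
    using smooth_on_vector_derivative[OF smc] d(1) by simp
  from vector_derivative_diff_chain_within[OF this, of \<phi> "frechet_derivative \<phi> (at p)"] smooth_onD[OF ch(5,2)]
  have 1: "((\<phi> \<circ> c) has_vector_derivative frechet_derivative \<phi> (at p) (frechet_derivative c (at 0) 1)) (at 0)"
    by (simp add: c0 has_derivative_at_withinI)
  have "((\<phi> \<circ> c) has_vector_derivative e0) (at 0)"
  proof (rule has_vector_derivative_transform_within_open[OF lin_l])
    show "l t = (\<phi> \<circ> c) t" if "t \<in> ?I" for t
      using homeomorphism_apply2[OF ch(4) lV[OF that]] by (simp add: c_def)
  qed (use d(1) in auto)
  with 1 have "frechet_derivative \<phi> (at p) (frechet_derivative c (at 0) 1) = e0"
    by (rule vector_derivative_unique_at)
  moreover have "frechet_derivative \<phi> (at p) 0 = 0"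
    using smooth_onD[OF ch(5,2)] has_derivative_linear linear_0 by blast
  ultimately have c'0: "frechet_derivative c (at 0) 1 \<noteq> 0" using e0(1) by auto
  have near: "\<exists>\<eta>>0. \<forall>M\<in>K. norm (M - p) < \<eta> \<longrightarrow> (\<exists>t\<in>{-s<..<s}. M = c t)" if s: "0 < s" for s
  proof -
    have "isCont \<phi> p"
      using smooth_on_continuous[OF ch(5)] ch(1,2) continuous_on_eq_continuous_at by blast
    moreover have "0 < s * norm e0" using s e0(1) by simp
    ultimately obtain \<eta>1 where \<eta>1: "0 < \<eta>1" "\<And>M. dist M p < \<eta>1 \<Longrightarrow> dist (\<phi> M) q < s * norm e0"
      unfolding continuous_at_eps_delta q_def by metis
    obtain \<eta>2 where \<eta>2: "0 < \<eta>2" "ball p \<eta>2 \<subseteq> U" using ch(1,2) open_contains_ball by blast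
    show ?thesis
    proof (intro exI[of _ "min \<eta>1 \<eta>2"] conjI ballI impI)
      fix M assume M: "M \<in> K" "norm (M - p) < min \<eta>1 \<eta>2"
      then have "M \<in> U" using \<eta>2(2) by (auto simp: dist_norm norm_minus_commute)
      then have "\<phi> M \<in> E" using ch(9) M(1) by blast
      then have "\<phi> M - q \<in> E" using subspace_diff[OF ch(7)] qV(2) by blast
      then obtain t where "\<phi> M - q = t *\<^sub>R e0" using spanE by blast
      then have t: "\<phi> M = l t" by (simp add: l_def algebra_simps)
      have "dist (\<phi> M) q < s * norm e0" using M(2) by (intro \<eta>1(2)) (simp add: dist_norm)
      then have "\<bar>t\<bar> < s" using e0(1) by (simp add: t l_def dist_norm)
      moreover have "M = c t"
        using homeomorphism_apply1[OF ch(4) \<open>M \<in> U\<close>] by (simp add: c_def t)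
      ultimately show "\<exists>t\<in>{-s<..<s}. M = c t" by (auto simp: abs_less_iff)
    qed (use \<eta>1 \<eta>2 in auto)
  qed
  show thesis using that[OF d(1) smc c0 _ c'0 near] cK by blast
qed

text \<open>A smooth map that agrees with \<open>f\<close> on the part of \<open>T\<close> near \<open>S\<close>. The derivative is bounded only at
  points of \<open>T\<close>: this makes the bound stable under gluing, and continuity extends it to a
  neighbourhood, with a slightly larger constant.\<close>

definition smooth_extension_near ::
  "real \<Rightarrow> 'a::euclidean_space set \<Rightarrow> ('a \<Rightarrow> 'b::euclidean_space) \<Rightarrow> 'a set \<Rightarrow> bool" where
  "smooth_extension_near k T f S \<longleftrightarrow> (\<exists>F W. smooth_on F UNIV \<and> open W \<and> S \<subseteq> W \<and>
     (\<forall>x\<in>T \<inter> W. F x = f x \<and> (\<forall>v. norm (frechet_derivative F (at x) v) \<le> k * norm v)))"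

text \<open>Parametrise \<open>K\<close> near \<open>p\<close> by a curve \<open>c\<close>. Its projection \<open>P \<circ> c\<close> has nonzero velocity, because \<open>P\<close>
  is bi-Lipschitz on \<open>K\<close>. Let \<open>e\<close> be the unit tangent vector of \<open>P \<circ> c\<close> at \<open>P p\<close>. The coordinate
  \<open>s(t) = P(c(t)) \<bullet> e\<close> has a smooth inverse \<open>\<tau>\<close>, and \<open>x \<mapsto> Q(c(\<tau>(x \<bullet> e)))\<close> is the extension. Its
  derivative has norm \<open>|(Q \<circ> c)'| / s' \<le> k |(P \<circ> c)'| / s'\<close>, and the quotient of the speed
  \<open>|(P \<circ> c)'|\<close> by its component \<open>s'\<close> along \<open>e\<close> is close to \<open>1\<close> near \<open>p\<close>. This is where \<open>k\<close> must be
  enlarged to \<open>k1\<close>.\<close>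

lemma smooth_extension_near_projected_curve:
  fixes K :: "'c::euclidean_space set" and P :: "'c \<Rightarrow> 'a::euclidean_space" and Q :: "'c \<Rightarrow> 'b::euclidean_space"
  assumes K: "smooth_submanifold 1 K" and P: "bounded_linear P" and Q: "bounded_linear Q"
    and C: "0 < C" and inj: "\<And>M M'. M \<in> K \<Longrightarrow> M' \<in> K \<Longrightarrow> norm (M - M') \<le> C * norm (P M - P M')"
    and k: "0 \<le> k" "k < k1" and lip: "\<And>M M'. M \<in> K \<Longrightarrow> M' \<in> K \<Longrightarrow> norm (Q M - Q M') \<le> k * norm (P M - P M')"
    and p: "p \<in> K" and f: "\<And>M. M \<in> K \<Longrightarrow> f (P M) = Q M"
  shows "smooth_extension_near k1 (P ` K) f {P p}"
proof -
  obtain c :: "real \<Rightarrow> 'c" and d where c: "0 < d" "smooth_on c {-d<..<d}" "c 0 = p"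
    "\<And>t. t \<in> {-d<..<d} \<Longrightarrow> c t \<in> K" "frechet_derivative c (at 0) 1 \<noteq> 0"
    "\<And>r. 0 < r \<Longrightarrow> \<exists>\<eta>>0. \<forall>M\<in>K. norm (M - p) < \<eta> \<longrightarrow> (\<exists>t\<in>{-r<..<r}. M = c t)"
    by (rule submanifold_local_curve[OF K p]) (rule that)
  define c' where "c' t = frechet_derivative c (at t) 1" for t
  let ?I = "{-d<..<d}"
  have dc: "(c has_vector_derivative c' t) (at t)" if "t \<in> ?I" for t
    using smooth_on_vector_derivative[OF c(2) that] by (simp add: c'_def)
  note dP = bounded_linear.has_vector_derivative[OF P dc]
  note dQ = bounded_linear.has_vector_derivative[OF Q dc]
  have ev: "\<forall>\<^sub>F s in at t. s \<in> ?I" if "t \<in> ?I" for t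
    using that by (intro eventually_at_in_open') auto
  have Qle: "norm (Q (c' t)) \<le> k * norm (P (c' t))" if t: "t \<in> ?I" for t
    by (rule vector_derivative_norm_le[OF dQ[OF t] dP[OF t]], rule eventually_mono[OF ev[OF t]])
      (rule lip[OF c(4) c(4)[OF t]])
  have cle: "norm (c' t) \<le> C * norm (P (c' t))" if t: "t \<in> ?I" for t
    by (rule vector_derivative_norm_le[OF dc[OF t] dP[OF t]], rule eventually_mono[OF ev[OF t]])
      (rule inj[OF c(4) c(4)[OF t]])
  define a where "a = P (c' 0)"
  have "0 < norm (c' 0)" using c(5) by (simp add: c'_def)
  also have "\<dots> \<le> C * norm a" using cle[of 0] c(1) by (simp add: a_def)
  finally have "0 < C * norm a" .
  then have a: "0 < norm a" using C by (simp add: zero_less_mult_iff)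
  define e where "e = a /\<^sub>R norm a"
  have e: "norm e = 1" "a \<bullet> e = norm a"
    using a by (auto simp: e_def inner_commute power2_norm_eq_inner[symmetric] power2_eq_square)
  \<comment> \<open>Positivity of \<open>g\<close> is what the derivative bound with \<open>k1\<close> requires. It holds at \<open>0\<close>, where the
  velocity is a multiple of \<open>e\<close>, and persists nearby by continuity.\<close>
  define g where "g t = k1 * (P (c' t) \<bullet> e) - k * norm (P (c' t))" for t
  have g0: "0 < g 0" using a k by (simp add: g_def e a_def[symmetric])
  have "continuous_on ?I c'"
    unfolding c'_def by (rule smooth_on_continuous[OF smooth_on_deriv[OF c(2)]])
  then have "continuous_on ?I g"
    unfolding g_def by (intro continuous_intros bounded_linear.continuous_on[OF P])
  then have "isCont g 0" using c(1) by (simp add: continuous_on_eq_continuous_at)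
  then obtain \<delta> where \<delta>: "0 < \<delta>" "\<And>t. dist t 0 < \<delta> \<Longrightarrow> dist (g t) (g 0) < g 0"
    using g0 unfolding continuous_at_eps_delta by metis
  define r where "r = min \<delta> d"
  have r: "0 < r" "r \<le> d" using \<delta>(1) c(1) by (auto simp: r_def)
  define S where "S = {-r<..<r}"
  have SI: "S \<subseteq> ?I" using r by (auto simp: S_def)
  have gpos: "k * norm (P (c' t)) < k1 * (P (c' t) \<bullet> e)" if "t \<in> S" for t
  proof -
    have "dist t 0 < \<delta>" using that by (auto simp: S_def r_def)
    from \<delta>(2)[OF this] show ?thesis by (simp add: dist_real_def g_def)
  qed
  define s where "s t = P (c t) \<bullet> e" for t
  define s' where "s' t = P (c' t) \<bullet> e" for t
  have spos: "0 < s' t" if "t \<in> S" for t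
  proof -
    have "0 \<le> k * norm (P (c' t))" using k by simp
    also have "\<dots> < k1 * s' t" using gpos[OF that] by (simp add: s'_def)
    finally show ?thesis using k by (simp add: zero_less_mult_iff)
  qed
  have bl: "bounded_linear (\<lambda>M. P M \<bullet> e)"
    by (rule bounded_linear_compose[OF bounded_linear_inner_left P])
  have ds: "(s has_real_derivative s' t) (at t)" if "t \<in> S" for t
    using bounded_linear.has_vector_derivative[OF bl dc] SI that
    by (auto simp: s_def[abs_def] s'_def has_real_derivative_iff_has_vector_derivative)
  have oS: "open S" by (simp add: S_def)
  have smc: "smooth_on c S" by (rule smooth_on_subset[OF c(2) SI])
  have "smooth_on s S"
    unfolding s_def by (rule smooth_on_compose[OF oS open_UNIV _ smooth_on_linear[OF bl] smc]) simp
  then obtain \<tau> where \<tau>: "open (s ` S)" "smooth_on \<tau> (s ` S)" "\<And>t. t \<in> S \<Longrightarrow> \<tau> (s t) = t"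
    "\<And>t. t \<in> S \<Longrightarrow> (\<tau> has_real_derivative inverse (s' t)) (at (s t))"
    using smooth_inverse_interval[OF S_def _ ds spos] by metis
  define X where "X = {x :: 'a. x \<bullet> e \<in> s ` S}"
  have oX: "open X"
    using open_vimage[OF \<tau>(1), of "\<lambda>x::'a. x \<bullet> e"] by (simp add: X_def vimage_def continuous_intros)
  define F0 where "F0 x = Q (c (\<tau> (x \<bullet> e)))" for x
  have "smooth_on (\<lambda>x. \<tau> (x \<bullet> e)) X"
    by (rule smooth_on_compose[OF oX \<tau>(1) _ \<tau>(2) smooth_on_linear[OF bounded_linear_inner_left]])
      (auto simp: X_def)
  then have "smooth_on (\<lambda>x. c (\<tau> (x \<bullet> e))) X"
    using \<tau>(3) by (intro smooth_on_compose[OF oX oS _ smc]) (auto simp: X_def)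
  then have smF0: "smooth_on F0 X"
    unfolding F0_def by (intro smooth_on_compose[OF oX open_UNIV _ smooth_on_linear[OF Q]]) auto
  have F0: "norm (frechet_derivative F0 (at x) v) \<le> k1 * norm v" if x: "x \<in> X" for x v
  proof -
    obtain t where t: "t \<in> S" "x \<bullet> e = s t" using x by (auto simp: X_def)
    have "((\<lambda>x. \<tau> (x \<bullet> e)) has_derivative (\<lambda>v. inverse (s' t) * (v \<bullet> e))) (at x)"
      using \<tau>(4)[OF t(1)] unfolding has_field_derivative_def
      by (intro has_derivative_compose[of "\<lambda>x. x \<bullet> e" _ _ _ \<tau>])
        (auto simp: t(2) intro!: derivative_eq_intros)
    moreover have "((\<lambda>u. Q (c u)) has_derivative (\<lambda>h. h *\<^sub>R Q (c' t))) (at (\<tau> (x \<bullet> e)))"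
      using dQ[of t] SI t \<tau>(3) unfolding has_vector_derivative_def by auto
    ultimately have "(F0 has_derivative (\<lambda>v. (inverse (s' t) * (v \<bullet> e)) *\<^sub>R Q (c' t))) (at x)"
      unfolding F0_def by (rule has_derivative_compose)
    from fun_cong[OF frechet_derivative_at[OF this], of v, symmetric]
    have "norm (frechet_derivative F0 (at x) v) = inverse (s' t) * \<bar>v \<bullet> e\<bar> * norm (Q (c' t))"
      by (rule ssubst) (use spos[OF t(1)] in \<open>simp add: abs_mult\<close>)
    also have "\<dots> \<le> inverse (s' t) * norm v * (k1 * s' t)"
    proof (intro mult_mono)
      show "\<bar>v \<bullet> e\<bar> \<le> norm v" using Cauchy_Schwarz_ineq2[of v e] e(1) by simp
      show "norm (Q (c' t)) \<le> k1 * s' t"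
        using Qle[of t] gpos[OF t(1)] SI t(1) by (auto simp: s'_def)
    qed (use spos[OF t(1)] in auto)
    also have "\<dots> = k1 * norm v" using spos[OF t(1)] by (simp add: field_simps)
    finally show ?thesis .
  qed
  have "0 \<in> S" using r by (simp add: S_def)
  then have "P p \<in> X" using c(3) by (auto simp: X_def s_def)
  then obtain \<theta> :: "'a \<Rightarrow> real" and V D where \<theta>: "smooth_on \<theta> UNIV" "open V" "{P p} \<subseteq> V" "V \<subseteq> X"
    "\<And>x. x \<in> V \<Longrightarrow> \<theta> x = 1" "closed D" "D \<subseteq> X" "\<And>x. x \<notin> D \<Longrightarrow> \<theta> x = 0"
    using smooth_cutoff_compact[of "{P p}" X] oX by (metis compact_sing empty_subsetI insert_subset)
  define F where "F x = \<theta> x *\<^sub>R F0 x" for x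
  have smF: "smooth_on F UNIV"
    unfolding F_def by (rule smooth_on_cutoff[OF \<theta>(1) oX \<theta>(6,7,8) smF0])
  obtain \<eta> where \<eta>: "0 < \<eta>" "\<forall>M\<in>K. norm (M - p) < \<eta> \<longrightarrow> (\<exists>t\<in>{-r<..<r}. M = c t)"
    using c(6)[OF r(1)] by blast
  define W where "W = V \<inter> ball (P p) (\<eta> / C)"
  have "F x = f x \<and> (\<forall>v. norm (frechet_derivative F (at x) v) \<le> k1 * norm v)" if x: "x \<in> P ` K \<inter> W" for x
  proof
    obtain M where M: "M \<in> K" "x = P M" using x by blast
    have "norm (P M - P p) < \<eta> / C" using x M(2) by (simp add: W_def dist_norm norm_minus_commute)
    then have "C * norm (P M - P p) < \<eta>" using C by (simp add: field_simps)
    then have "norm (M - p) < \<eta>" using inj[OF M(1) p] by simp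
    then obtain t where t: "t \<in> S" "M = c t" using \<eta>(2) M(1) by (auto simp: S_def)
    have V: "x \<in> V" using x by (simp add: W_def)
    have "F0 x = Q M" by (simp add: F0_def M(2) t(2) s_def[symmetric] \<tau>(3)[OF t(1)])
    then show "F x = f x" using f[OF M(1)] \<theta>(5)[OF V] by (simp add: F_def M(2))
    have "x \<in> X" using V \<theta>(4) by blast
    have "F0 y = F y" if "y \<in> V" for y using \<theta>(5)[OF that] by (simp add: F_def)
    then have "(F has_derivative frechet_derivative F0 (at x)) (at x)"
      by (rule has_derivative_transform_within_open[OF smooth_onD[OF smF0 \<open>x \<in> X\<close>] \<theta>(2) V])
    then have "frechet_derivative F (at x) = frechet_derivative F0 (at x)"
      by (rule frechet_derivative_at[symmetric])
    then show "\<forall>v. norm (frechet_derivative F (at x) v) \<le> k1 * norm v"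
      using F0[OF \<open>x \<in> X\<close>] by simp
  qed
  moreover have "open W" "{P p} \<subseteq> W" using \<theta>(2,3) \<eta>(1) C by (auto simp: W_def)
  ultimately show ?thesis unfolding smooth_extension_near_def using smF by blast
qed

section \<open>Extension with almost the same Lipschitz constant\<close>

text \<open>Interpolate with a cutoff \<open>\<theta>\<close>. At a point of \<open>T\<close> where both extensions are valid they have the
  same value, hence the derivative of \<open>\<theta>\<close> drops out and the derivative of the interpolation is a
  convex combination of the two derivatives.\<close>

lemma smooth_extension_near_Un:
  assumes S1: "compact S1" and 1: "smooth_extension_near k T f S1" and 2: "smooth_extension_near k T f S2"
  shows "smooth_extension_near k T f (S1 \<union> S2)"
proof -
  obtain F1 W1 where F1: "smooth_on F1 UNIV" "open W1" "S1 \<subseteq> W1"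
    "\<And>x. x \<in> T \<Longrightarrow> x \<in> W1 \<Longrightarrow> F1 x = f x"
    "\<And>x v. x \<in> T \<Longrightarrow> x \<in> W1 \<Longrightarrow> norm (frechet_derivative F1 (at x) v) \<le> k * norm v"
    using 1 unfolding smooth_extension_near_def by blast
  obtain F2 W2 where F2: "smooth_on F2 UNIV" "open W2" "S2 \<subseteq> W2"
    "\<And>x. x \<in> T \<Longrightarrow> x \<in> W2 \<Longrightarrow> F2 x = f x"
    "\<And>x v. x \<in> T \<Longrightarrow> x \<in> W2 \<Longrightarrow> norm (frechet_derivative F2 (at x) v) \<le> k * norm v"
    using 2 unfolding smooth_extension_near_def by blast
  obtain \<theta> :: "'a \<Rightarrow> real" and V C where \<theta>: "smooth_on \<theta> UNIV" "open V" "S1 \<subseteq> V" "V \<subseteq> W1"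
    "\<And>x. x \<in> V \<Longrightarrow> \<theta> x = 1" "closed C" "C \<subseteq> W1" "\<And>x. x \<notin> C \<Longrightarrow> \<theta> x = 0"
    "\<And>x. 0 \<le> \<theta> x" "\<And>x. \<theta> x \<le> 1"
    using smooth_cutoff_compact[OF S1 F1(2,3)] by metis
  define F where "F x = F2 x + \<theta> x *\<^sub>R (F1 x - F2 x)" for x
  let ?D = "\<lambda>F x. frechet_derivative F (at x)"
  have smF: "smooth_on F UNIV"
    unfolding F_def by (intro smooth_on_add smooth_on_scaleR smooth_on_diff \<theta> F1 F2 open_UNIV)
  have "(F has_derivative (\<lambda>v. ?D F2 x v + (\<theta> x *\<^sub>R (?D F1 x v - ?D F2 x v) + ?D \<theta> x v *\<^sub>R (F1 x - F2 x)))) (at x)" for x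
    unfolding F_def
    by (intro has_derivative_add has_derivative_scaleR has_derivative_diff smooth_onD[OF F1(1)]
        smooth_onD[OF F2(1)] smooth_onD[OF \<theta>(1)] UNIV_I)
  then have DF: "?D F x v = ?D F2 x v + (\<theta> x *\<^sub>R (?D F1 x v - ?D F2 x v) + ?D \<theta> x v *\<^sub>R (F1 x - F2 x))" for x v
    by (rule frechet_derivative_at[THEN fun_cong, symmetric])
  have loc: "?D F x = ?D G x" if "open A" "x \<in> A" "\<And>y. y \<in> A \<Longrightarrow> F y = G y" "smooth_on G UNIV" for A x and G :: "'a \<Rightarrow> 'b"
  proof -
    have "(F has_derivative ?D G x) (at x)"
      using has_derivative_transform_within_open[OF smooth_onD[OF that(4)] that(1,2)] that(3) by simp
    then show ?thesis by (rule frechet_derivative_at[symmetric])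
  qed
  have "F x = f x \<and> (\<forall>v. norm (?D F x v) \<le> k * norm v)" if x: "x \<in> T" "x \<in> V \<union> W2" for x
  proof -
    consider "x \<in> V" | "x \<in> W2" "x \<in> W1" | "x \<in> W2" "x \<notin> C" using x(2) \<theta>(7) by blast
    then show ?thesis
    proof cases
      case 1
      have "F y = F1 y" if "y \<in> V" for y using \<theta>(5)[OF that] by (simp add: F_def)
      then show ?thesis using loc[OF \<theta>(2) 1 _ F1(1)] F1(4,5) x(1) 1 \<theta>(4) by (metis subsetD)
    next
      case 2
      have eq: "F1 x = f x" "F2 x = f x" using F1(4) F2(4) x(1) 2 by auto
      have "norm (?D F x v) \<le> k * norm v" for v
      proof -
        have "?D F x v = (1 - \<theta> x) *\<^sub>R ?D F2 x v + \<theta> x *\<^sub>R ?D F1 x v"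
          by (simp add: DF eq algebra_simps)
        also have "norm \<dots> \<le> (1 - \<theta> x) * norm (?D F2 x v) + \<theta> x * norm (?D F1 x v)"
          using norm_triangle_ineq[of "(1 - \<theta> x) *\<^sub>R ?D F2 x v" "\<theta> x *\<^sub>R ?D F1 x v"] \<theta>(9,10)[of x] by simp
        also have "\<dots> \<le> (1 - \<theta> x) * (k * norm v) + \<theta> x * (k * norm v)"
          using \<theta>(9,10)[of x] F1(5)[OF x(1) 2(2)] F2(5)[OF x(1) 2(1)] by (intro add_mono mult_left_mono) auto
        finally show ?thesis by (simp add: algebra_simps)
      qed
      then show ?thesis by (simp add: F_def eq)
    next
      case 3
      have "F y = F2 y" if "y \<in> - C" for y using \<theta>(8) that by (simp add: F_def)
      then show ?thesis
        using loc[of "- C" x F2] F2 x(1) 3 \<theta>(6) by (metis ComplI open_Compl)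
    qed
  qed
  then show ?thesis
    unfolding smooth_extension_near_def
    using smF \<theta>(2,3) F2(2,3) by (intro exI[of _ F] exI[of _ "V \<union> W2"]) auto
qed

lemma smooth_extension_near_compact:
  assumes T: "compact T" and loc: "\<And>x. x \<in> T \<Longrightarrow> smooth_extension_near k T f {x}"
  shows "smooth_extension_near k T f T"
proof -
  have "\<exists>r>0. smooth_extension_near k T f (cball x r)" if x: "x \<in> T" for x
  proof -
    obtain F W where F: "smooth_on F UNIV" "open W" "{x} \<subseteq> W"
      "\<forall>x\<in>T \<inter> W. F x = f x \<and> (\<forall>v. norm (frechet_derivative F (at x) v) \<le> k * norm v)"
      using loc[OF x] unfolding smooth_extension_near_def by blast
    moreover obtain r where "0 < r" "cball x r \<subseteq> W" using F open_contains_cball by blast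
    ultimately show ?thesis unfolding smooth_extension_near_def by blast
  qed
  then obtain r where r: "\<And>x. x \<in> T \<Longrightarrow> 0 < r x" "\<And>x. x \<in> T \<Longrightarrow> smooth_extension_near k T f (cball x (r x))"
    by metis
  have "T \<subseteq> (\<Union>x\<in>T. ball x (r x))" using r(1) by force
  from compactE_image[OF T open_ball this]
  obtain I where I: "I \<subseteq> T" "finite I" "T \<subseteq> (\<Union>x\<in>I. ball x (r x))" .
  have "smooth_extension_near k T f (\<Union>x\<in>J. cball x (r x))" if "finite J" "J \<subseteq> T" for J
    using that
  proof (induction J rule: finite_induct)
    case empty
    show ?case unfolding smooth_extension_near_def
      by (intro exI[of _ "\<lambda>_. 0"] exI[of _ "{}"]) (simp add: smooth_on_const)
  next
    case (insert x J)
    then show ?case using smooth_extension_near_Un[OF compact_cball r(2)] by simp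
  qed
  from this[OF I(2,1)] obtain F W where FW: "smooth_on F UNIV" "open W" "(\<Union>x\<in>I. cball x (r x)) \<subseteq> W"
      "\<forall>x\<in>T \<inter> W. F x = f x \<and> (\<forall>v. norm (frechet_derivative F (at x) v) \<le> k * norm v)"
    unfolding smooth_extension_near_def by blast
  have "T \<subseteq> (\<Union>x\<in>I. cball x (r x))"
    by (rule order_trans[OF I(3)]) (intro UN_mono order_refl ball_subset_cball)
  then have "T \<subseteq> W" using FW(3) by (rule order_trans)
  then show ?thesis
    unfolding smooth_extension_near_def using FW(1,2,4) by (intro exI[of _ F] exI[of _ W]) simp
qed

text \<open>Use \<open>F0\<close> near \<open>T\<close> and a mollification \<open>G\<close> of \<open>F\<close> at scale \<open>d\<close> away from \<open>T\<close>. Where the cutoff varies,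
  its slope is at most \<open>3/d\<close>, and \<open>|F0 - G| \<le> 3 k d\<close>: at a point of \<open>T\<close> within distance \<open>d\<close> the
  maps \<open>F0\<close> and \<open>F\<close> agree, each of them changes by at most \<open>k d\<close> from there, and mollifying \<open>F\<close> contributes another
  \<open>k d\<close>. The resulting error \<open>9 k\<close> does not depend on \<open>d\<close>.\<close>

lemma smooth_extension_one_scale:
  fixes F F0 :: "'a::euclidean_space \<Rightarrow> 'b::euclidean_space"
  assumes T: "compact T" "T \<noteq> {}" and d: "0 < d" and F: "k-lipschitz_on UNIV F" and F0: "smooth_on F0 UNIV"
    and eq: "\<And>x. x \<in> T \<Longrightarrow> F0 x = F x"
    and bound: "\<And>x y v. x \<in> T \<Longrightarrow> y \<in> ball x d \<Longrightarrow> norm (frechet_derivative F0 (at y) v) \<le> k * norm v"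
  obtains H where "smooth_on H UNIV" "\<And>x. x \<in> T \<Longrightarrow> H x = F x"
    "\<And>x v. norm (frechet_derivative H (at x) v)
       \<le> (k + (if infdist x T \<in> {d / 12..11 * d / 12} then 9 * k else 0)) * norm v"
proof -
  let ?D = "\<lambda>F x. frechet_derivative F (at x)"
  have k: "0 \<le> k" using F by (rule lipschitz_on_nonneg)
  obtain G where G: "smooth_on G UNIV" "k-lipschitz_on UNIV G" "\<And>x. norm (G x - F x) \<le> k * d"
    using lipschitz_smoothing_dist[OF F d] by metis
  obtain \<theta> :: "'a \<Rightarrow> real" where \<theta>: "smooth_on \<theta> UNIV" "(3 / d)-lipschitz_on UNIV \<theta>"
    "\<And>x. 0 \<le> \<theta> x" "\<And>x. \<theta> x \<le> 1"
    "\<And>x. infdist x T < d / 12 \<Longrightarrow> \<theta> x = 1" "\<And>x. 11 * d / 12 < infdist x T \<Longrightarrow> \<theta> x = 0"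
    using smooth_distance_cutoff[OF d T(2)] by metis
  define H where "H x = G x + \<theta> x *\<^sub>R (F0 x - G x)" for x
  have smH: "smooth_on H UNIV"
    unfolding H_def by (intro smooth_on_add smooth_on_scaleR smooth_on_diff \<theta> F0 G open_UNIV)
  have "(H has_derivative (\<lambda>v. ?D G x v + (\<theta> x *\<^sub>R (?D F0 x v - ?D G x v) + ?D \<theta> x v *\<^sub>R (F0 x - G x)))) (at x)" for x
    unfolding H_def
    by (intro has_derivative_add has_derivative_scaleR has_derivative_diff smooth_onD[OF F0]
        smooth_onD[OF G(1)] smooth_onD[OF \<theta>(1)] UNIV_I)
  then have DH: "?D H x v = ?D G x v + (\<theta> x *\<^sub>R (?D F0 x v - ?D G x v) + ?D \<theta> x v *\<^sub>R (F0 x - G x))" for x v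
    by (rule frechet_derivative_at[THEN fun_cong, symmetric])
  have loc: "?D H x = ?D J x" if "open A" "x \<in> A" "\<And>y. y \<in> A \<Longrightarrow> J y = H y" "smooth_on J UNIV" for A x and J :: "'a \<Rightarrow> 'b"
    by (rule frechet_derivative_at[symmetric],
        rule has_derivative_transform_within_open[OF smooth_onD[OF that(4) UNIV_I] that(1,2)], rule that(3))
  have DG: "norm (?D G x v) \<le> k * norm v" for x v
    by (rule lipschitz_imp_derivative_bound[OF G(2) smooth_onD[OF G(1) UNIV_I]])
  have D\<theta>: "\<bar>?D \<theta> x v\<bar> \<le> 3 / d * norm v" for x v
    using lipschitz_imp_derivative_bound[OF \<theta>(2) smooth_onD[OF \<theta>(1) UNIV_I]] by simp
  have near: "\<exists>z\<in>T. x \<in> ball z d" if "infdist x T < d" for x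
  proof -
    obtain z where "z \<in> T" "infdist x T = dist x z"
      using infdist_attains_inf[OF compact_imp_closed[OF T(1)] T(2)] by metis
    then show ?thesis using that by (intro bexI[of _ z]) (simp_all add: dist_commute)
  qed
  have DF0: "norm (?D F0 x v) \<le> k * norm v" if x: "infdist x T < d" for x v
    using near[OF x] bound by blast
  have "norm (?D H x v) \<le> (k + (if infdist x T \<in> {d / 12..11 * d / 12} then 9 * k else 0)) * norm v" for x v
  proof -
    consider "infdist x T < d / 12" | "11 * d / 12 < infdist x T" | "infdist x T \<in> {d / 12..11 * d / 12}"
      by fastforce
    then show ?thesis
    proof cases
      case 1
      have "?D H x = ?D F0 x"
      proof (rule loc)
        show "open {y. infdist y T < d / 12}" by (intro open_Collect_less continuous_intros)
      qed (use 1 \<theta>(5) F0 in \<open>auto simp: H_def\<close>)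
      then show ?thesis using DF0[of x v] 1 d by simp
    next
      case 2
      have "?D H x = ?D G x"
      proof (rule loc)
        show "open {y. 11 * d / 12 < infdist y T}" by (intro open_Collect_less continuous_intros)
      qed (use 2 \<theta>(6) G in \<open>auto simp: H_def\<close>)
      then show ?thesis using DG[of x v] 2 d by simp
    next
      case 3
      then have xd: "infdist x T < d" using d by simp
      then obtain z where z: "z \<in> T" "x \<in> ball z d" using near by blast
      have "k-lipschitz_on (ball z d) F0"
        using bound[OF z(1)] k F0
        by (intro derivative_bound_imp_lipschitz[where D="?D F0"] smooth_onD[OF F0]) auto
      from lipschitz_onD[OF this z(2), of z] d
      have "norm (F0 x - F z) \<le> k * dist x z" by (simp add: dist_norm eq[OF z(1)])
      moreover have "norm (F x - F z) \<le> k * dist x z"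
        using lipschitz_onD[OF F, of x z] by (simp add: dist_norm)
      moreover have "k * dist x z \<le> k * d" using k z(2) by (intro mult_left_mono) (auto simp: dist_commute)
      moreover have "norm (F0 x - G x) \<le> norm (F0 x - F z) + norm (F x - F z) + norm (G x - F x)"
        using norm_triangle_ineq4[of "F0 x - F z" "F x - F z"] norm_triangle_ineq4[of "F0 x - F x" "G x - F x"]
        by (simp add: algebra_simps)
      ultimately have diff: "norm (F0 x - G x) \<le> 3 * k * d" using G(3)[of x] by linarith
      have "?D H x v = ((1 - \<theta> x) *\<^sub>R ?D G x v + \<theta> x *\<^sub>R ?D F0 x v) + ?D \<theta> x v *\<^sub>R (F0 x - G x)"
        by (simp add: DH algebra_simps)
      also have "norm \<dots> \<le> ((1 - \<theta> x) * norm (?D G x v) + \<theta> x * norm (?D F0 x v)) + \<bar>?D \<theta> x v\<bar> * norm (F0 x - G x)"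
        using \<theta>(3,4)[of x] by (intro norm_triangle_le add_mono) auto
      also have "\<dots> \<le> ((1 - \<theta> x) * (k * norm v) + \<theta> x * (k * norm v)) + (3 / d * norm v) * (3 * k * d)"
        using \<theta>(3,4)[of x] DG DF0[OF xd] D\<theta> diff d by (intro add_mono mult_left_mono mult_mono) auto
      also have "\<dots> = (k + 9 * k) * norm v" using d by (simp add: field_simps)
      finally show ?thesis using 3 by simp
    qed
  qed
  moreover have "H x = F x" if "x \<in> T" for x
    using that \<theta>(5)[of x] d eq by (simp add: H_def)
  ultimately show thesis using that smH by blast
qed

text \<open>The shells at the scales \<open>\<delta> i = d / 12^i\<close>, where the extension at scale \<open>\<delta> i\<close> has a bad derivative
  bound, are pairwise disjoint. At each point, therefore, at most one of the \<open>m\<close> extensions that are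
  averaged contributes the error \<open>9 km\<close>.\<close>

theorem smooth_lipschitz_extension:
  fixes f :: "'a::euclidean_space \<Rightarrow> 'b::euclidean_space"
  assumes T: "compact T" "T \<noteq> {}" and f: "k-lipschitz_on T f" and k: "k \<le> k1" "k1 < k2"
    and near: "smooth_extension_near k1 T f T"
  obtains H where "smooth_on H UNIV" "k2-lipschitz_on UNIV H" "\<And>x. x \<in> T \<Longrightarrow> H x = f x"
proof -
  let ?D = "\<lambda>F x. frechet_derivative F (at x)"
  define km where "km = (k1 + k2) / 2"
  have km: "k \<le> km" "k1 < km" "km < k2" using k by (auto simp: km_def)
  obtain F0 W where F0: "smooth_on F0 UNIV" "open W" "T \<subseteq> W"
    "\<forall>x\<in>T \<inter> W. F0 x = f x \<and> (\<forall>v. norm (?D F0 x v) \<le> k1 * norm v)"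
    using near unfolding smooth_extension_near_def by (elim exE conjE) (rule that)
  then have F0T: "F0 x = f x" "norm (?D F0 x v) \<le> k1 * norm v" if "x \<in> T" for x v
    using that by auto
  obtain d where d: "0 < d" "\<And>x y v. x \<in> T \<Longrightarrow> y \<in> ball x d \<Longrightarrow> norm (?D F0 y v) \<le> km * norm v"
    using derivative_bound_near_compact[OF F0(1) T(1) km(2) F0T(2)] by metis
  obtain F where F: "k-lipschitz_on UNIV F" "\<And>x. x \<in> T \<Longrightarrow> F x = f x"
    using kirszbraun[OF f] by metis
  have kmF: "km-lipschitz_on UNIV F" using lipschitz_on_le[OF F(1) km(1)] .
  then have km0: "0 \<le> km" by (rule lipschitz_on_nonneg)
  define \<delta> where "\<delta> i = d / 12 ^ i" for i
  have \<delta>: "0 < \<delta> i" "\<delta> i \<le> d" for i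
    using d(1) one_le_power[of "12::real" i] by (auto simp: \<delta>_def field_simps mult_le_cancel_left1)
  have \<delta>_dec: "\<delta> j \<le> \<delta> i / 12" if "i < j" for i j
  proof -
    have "(12::real) ^ Suc i \<le> 12 ^ j" using that by (intro power_increasing) auto
    then show ?thesis using d(1) by (simp add: \<delta>_def field_simps)
  qed
  define A where "A i = {x. infdist x T \<in> {\<delta> i / 12..11 * \<delta> i / 12}}" for i
  have disj: "i = j" if "x \<in> A i" "x \<in> A j" for x i j
  proof -
    have "\<not> i < j" if "x \<in> A i" "x \<in> A j" for i j
      using that \<delta>_dec[of i j] \<delta>(1)[of j] by (auto simp: A_def)
    then show ?thesis using that by (metis linorder_neqE_nat)
  qed
  have "\<exists>H. smooth_on H UNIV \<and> (\<forall>x\<in>T. H x = f x) \<and>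
    (\<forall>x v. norm (?D H x v) \<le> (km + (if x \<in> A i then 9 * km else 0)) * norm v)" for i
  proof -
    have "norm (?D F0 y v) \<le> km * norm v" if "x \<in> T" "y \<in> ball x (\<delta> i)" for x y v
      using d(2)[OF that(1)] that(2) \<delta>(2)[of i] by simp
    note bound = this
    have eq: "F0 x = F x" if "x \<in> T" for x using F0T(1) F(2) that by simp
    obtain H where "smooth_on H UNIV" "\<And>x. x \<in> T \<Longrightarrow> H x = F x"
      "\<And>x v. norm (?D H x v) \<le> (km + (if infdist x T \<in> {\<delta> i / 12..11 * \<delta> i / 12} then 9 * km else 0)) * norm v"
      by (rule smooth_extension_one_scale[OF T \<delta>(1)[of i] kmF F0(1) eq bound]) (assumption, assumption, assumption, rule that)
    then show ?thesis using F(2) by (intro exI[of _ H]) (simp add: A_def)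
  qed
  then obtain H where H: "\<And>i. smooth_on (H i) UNIV" "\<And>i x. x \<in> T \<Longrightarrow> H i x = f x"
    "\<And>i x v. norm (?D (H i) x v) \<le> (km + (if x \<in> A i then 9 * km else 0)) * norm v"
    by metis
  obtain m :: nat where m: "9 * km / (k2 - km) < real m" using reals_Archimedean2 by blast
  have "0 \<le> 9 * km / (k2 - km)" using km0 km(3) by simp
  then have m0: "0 < real m" using m by linarith
  have m': "9 * km / m \<le> k2 - km" using m m0 km(3) by (simp add: field_simps)
  define G where "G x = (1 / m) *\<^sub>R (\<Sum>i<m. H i x)" for x
  have smG: "smooth_on G UNIV"
    unfolding G_def by (intro smooth_on_scaleR smooth_on_const smooth_on_sum H open_UNIV)
  have dG: "(G has_derivative (\<lambda>v. (1 / m) *\<^sub>R (\<Sum>i<m. ?D (H i) x v))) (at x)" for x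
    unfolding G_def by (intro has_derivative_scaleR_right has_derivative_sum smooth_onD[OF H(1)] UNIV_I)
  have "norm ((1 / m) *\<^sub>R (\<Sum>i<m. ?D (H i) x v)) \<le> k2 * norm v" for x v
  proof -
    have "(\<Sum>i<m. if x \<in> A i then 9 * km else 0) \<le> 9 * km"
    proof -
      have "card {i. i < m \<and> x \<in> A i} \<le> 1"
        using disj by (subst One_nat_def, subst card_le_Suc0_iff_eq) auto
      then have "real (card {i. i < m \<and> x \<in> A i}) * (9 * km) \<le> 1 * (9 * km)"
        using km0 by (intro mult_right_mono) auto
      moreover have "{..<m} \<inter> {i. x \<in> A i} = {i. i < m \<and> x \<in> A i}" by auto
      ultimately show ?thesis by (simp add: sum.If_cases)
    qed
    moreover have "norm (\<Sum>i<m. ?D (H i) x v) \<le> (\<Sum>i<m. (km + (if x \<in> A i then 9 * km else 0)) * norm v)"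
      by (rule sum_norm_le) (rule H(3))
    moreover have "(\<Sum>i<m. (km + (if x \<in> A i then 9 * km else 0)) * norm v)
        = (m * km + (\<Sum>i<m. if x \<in> A i then 9 * km else 0)) * norm v"
      by (simp only: sum_distrib_right[symmetric] sum.distrib sum_constant card_lessThan)
    ultimately have "norm (\<Sum>i<m. ?D (H i) x v) \<le> (m * km + 9 * km) * norm v"
      by (smt (verit, best) mult_right_mono norm_ge_zero)
    then have "norm ((1 / m) *\<^sub>R (\<Sum>i<m. ?D (H i) x v)) \<le> (1 / m) * ((m * km + 9 * km) * norm v)"
      using m0 by (simp add: divide_right_mono)
    also have "\<dots> = (km + 9 * km / m) * norm v" using m0 by (simp add: field_simps)
    also have "\<dots> \<le> k2 * norm v" using m' by (intro mult_right_mono) auto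
    finally show ?thesis .
  qed
  with dG have "k2-lipschitz_on UNIV G"
    using km km0 by (intro derivative_bound_imp_lipschitz) auto
  moreover have "G x = f x" if "x \<in> T" for x
    using H(2)[OF that] m0 by (simp add: G_def sum_constant_scaleR)
  ultimately show thesis using that smG by blast
qed

section \<open>Monotone fields through elliptic curves\<close>

text \<open>The map \<open>Q = g - m P\<close> is a \<open>k\<close>-Lipschitz function of \<open>P\<close> on \<open>K\<close> with \<open>k < m\<close>, by completing the square
  in the ellipticity inequality. A smooth extension \<open>H\<close> of this function with Lipschitz constant
  \<open>k2 < m\<close> perturbs the field \<open>x \<mapsto> m x\<close> too little to destroy its monotonicity.\<close>

lemma smooth_monotone_field:
  fixes K :: "'c::euclidean_space set" and P g :: "'c \<Rightarrow> 'a::euclidean_space"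
  assumes K: "smooth_submanifold 1 K" "compact K" "K \<noteq> {}"
    and P: "bounded_linear P" and g: "bounded_linear g"
    and norm: "\<And>M. (norm M)\<^sup>2 = (norm (P M))\<^sup>2 + (norm (g M))\<^sup>2"
    and C: "0 < C" and ell: "\<And>M M'. M \<in> K \<Longrightarrow> M' \<in> K \<Longrightarrow> (norm (M - M'))\<^sup>2 \<le> C * (g (M - M') \<bullet> P (M - M'))"
  obtains l G L where "0 < l" "smooth_on G UNIV" "L-lipschitz_on UNIV G" "\<And>M. M \<in> K \<Longrightarrow> G (P M) = g M"
    "\<And>X X'. l * (norm (X - X'))\<^sup>2 \<le> (G X - G X') \<bullet> (X - X')"
proof -
  \<comment> \<open>The ellipticity constant may be enlarged since the pairing that it multiplies is nonnegative on
  differences of points of \<open>K\<close>. This gives \<open>m > 1\<close>, so that the square root is meaningful.\<close>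
  define m where "m = max C 3 / 2"
  define k where "k = sqrt (m\<^sup>2 - 1)"
  have m: "3 / 2 \<le> m" by (simp add: m_def)
  then have "1 \<le> m\<^sup>2" using power_mono[of 1 m 2] by simp
  then have k: "0 \<le> k" "k\<^sup>2 = m\<^sup>2 - 1" by (auto simp: k_def)
  have km: "k < m" using m k by (intro power2_less_imp_less[of k m]) auto
  define Q where "Q M = g M - m *\<^sub>R P M" for M
  have Q: "bounded_linear Q"
    unfolding Q_def by (intro bounded_linear_sub g bounded_linear_const_scaleR P)
  note diff = linear_diff[OF bounded_linear.linear[OF P]] linear_diff[OF bounded_linear.linear[OF g]]
    linear_diff[OF bounded_linear.linear[OF Q]]
  have ell': "(norm N)\<^sup>2 \<le> 2 * m * (g N \<bullet> P N)" if "M \<in> K" "M' \<in> K" "N = M - M'" for M M' N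
  proof -
    have le: "(norm N)\<^sup>2 \<le> C * (g N \<bullet> P N)" using ell[OF that(1,2)] that(3) by simp
    then have "0 \<le> C * (g N \<bullet> P N)" by (rule order_trans[OF zero_le_power2])
    then have "0 \<le> g N \<bullet> P N" using C by (simp add: zero_le_mult_iff)
    then have "C * (g N \<bullet> P N) \<le> 2 * m * (g N \<bullet> P N)" by (intro mult_right_mono) (auto simp: m_def)
    with le show ?thesis by linarith
  qed
  have lipQ: "norm (Q M - Q M') \<le> k * norm (P M - P M')" if "M \<in> K" "M' \<in> K" for M M'
  proof -
    let ?N = "M - M'"
    have "(norm (Q ?N))\<^sup>2 = (norm (g ?N))\<^sup>2 - 2 * m * (g ?N \<bullet> P ?N) + m\<^sup>2 * (norm (P ?N))\<^sup>2"
      unfolding Q_def power2_norm_eq_inner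
      by (simp add: inner_diff_left inner_diff_right inner_commute power2_eq_square algebra_simps)
    also have "\<dots> \<le> (m\<^sup>2 - 1) * (norm (P ?N))\<^sup>2"
      using ell'[OF that refl] norm[of ?N] by (simp add: algebra_simps)
    also have "\<dots> = (k * norm (P ?N))\<^sup>2" using k by (simp add: power_mult_distrib)
    finally have "norm (Q ?N) \<le> k * norm (P ?N)"
      by (rule power2_le_imp_le) (use k(1) in simp)
    then show ?thesis by (simp add: diff)
  qed
  have inj: "norm (M - M') \<le> (1 + k + m) * norm (P M - P M')" if "M \<in> K" "M' \<in> K" for M M'
  proof -
    let ?N = "M - M'"
    have "norm (g ?N) \<le> norm (Q ?N) + m * norm (P ?N)"
      using norm_triangle_ineq[of "Q ?N" "m *\<^sub>R P ?N"] m by (simp add: Q_def)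
    then have "norm (g ?N) \<le> (k + m) * norm (P ?N)"
      using lipQ[OF that] m by (simp add: diff algebra_simps)
    moreover have "norm ?N \<le> norm (P ?N) + norm (g ?N)"
      by (rule power2_le_imp_le) (auto simp: norm power2_sum)
    ultimately have "norm ?N \<le> norm (P ?N) + (k + m) * norm (P ?N)" by linarith
    then show ?thesis by (simp add: diff algebra_simps)
  qed
  have injP: "inj_on P K"
    using inj by (intro inj_onI) fastforce
  define f where "f x = Q (inv_into K P x)" for x
  have f: "f (P M) = Q M" if "M \<in> K" for M using injP that by (simp add: f_def)
  have lipf: "k-lipschitz_on (P ` K) f"
    using lipQ k by (auto intro!: lipschitz_onI simp: f dist_norm)
  define k1 k2 where "k1 = (2 * k + m) / 3" and "k2 = (k + 2 * m) / 3"
  have k12: "k < k1" "k1 < k2" "k2 < m" using km by (auto simp: k1_def k2_def)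
  have T: "compact (P ` K)" "P ` K \<noteq> {}"
    using K compact_continuous_image[OF linear_continuous_on[OF P] K(2)] by auto
  have c: "0 < 1 + k + m" using k m by simp
  have "smooth_extension_near k1 (P ` K) f (P ` K)"
  proof (rule smooth_extension_near_compact[OF T(1)])
    fix x assume "x \<in> P ` K"
    then obtain M where M: "M \<in> K" "x = P M" by blast
    show "smooth_extension_near k1 (P ` K) f {x}"
      unfolding M(2)
      by (rule smooth_extension_near_projected_curve[OF K(1) P Q c inj k(1) k12(1) lipQ M(1) f])
  qed
  from smooth_lipschitz_extension[OF T lipf less_imp_le[OF k12(1)] k12(2) this]
  obtain H where H: "smooth_on H UNIV" "k2-lipschitz_on UNIV H" "\<And>x. x \<in> P ` K \<Longrightarrow> H x = f x" by metis
  define G where "G x = m *\<^sub>R x + H x" for x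
  show thesis
  proof (rule that)
    show "0 < m - k2" using k12 by simp
    show "smooth_on G UNIV"
      unfolding G_def
      by (intro smooth_on_add smooth_on_linear[OF bounded_linear_scaleR_right] H open_UNIV)
    have "m-lipschitz_on UNIV (\<lambda>x::'a. m *\<^sub>R x)"
      using m by (intro lipschitz_onI) (auto simp: dist_norm simp flip: scaleR_diff_right)
    then show "(m + k2)-lipschitz_on UNIV G"
      unfolding G_def by (rule lipschitz_on_add[OF _ H(2)])
    show "G (P M) = g M" if "M \<in> K" for M
      using that by (simp add: G_def H(3) f Q_def)
    show "(m - k2) * (norm (X - X'))\<^sup>2 \<le> (G X - G X') \<bullet> (X - X')" for X X'
    proof -
      have "- ((H X - H X') \<bullet> (X - X')) \<le> norm (H X - H X') * norm (X - X')"
        using norm_cauchy_schwarz[of "- (H X - H X')" "X - X'"] by (simp only: inner_minus_left norm_minus_cancel)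
      also have "\<dots> \<le> k2 * norm (X - X') * norm (X - X')"
        using lipschitz_onD[OF H(2), of X X'] by (intro mult_right_mono) (auto simp: dist_norm)
      finally have "- ((H X - H X') \<bullet> (X - X')) \<le> k2 * (norm (X - X'))\<^sup>2"
        by (simp add: power2_eq_square mult.assoc)
      moreover have "(G X - G X') \<bullet> (X - X') = m * ((X - X') \<bullet> (X - X')) + (H X - H X') \<bullet> (X - X')"
        by (simp add: G_def algebra_simps inner_diff_left inner_diff_right inner_add_left)
      ultimately show ?thesis by (simp add: power2_norm_eq_inner algebra_simps)
    qed
  qed
qed

lemma linear_mult_i: "linear mult_i"
  by (rule linearI) (simp_all add: mult_i_def vec_eq_iff forall_2)

lemma mult_i_mult_i: "mult_i (mult_i v) = - v" "mult_i (- v) = - mult_i v"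
  by (simp_all add: mult_i_def vec_eq_iff forall_2)

lemma norm_mult_i: "norm (mult_i v) = norm v"
  by (simp add: mult_i_def norm_eq_sqrt_inner inner_vec_def sum_2)

lemma norm_rows: "(norm (M :: real^2^2))\<^sup>2 = (norm (M $ 1))\<^sup>2 + (norm (M $ 2))\<^sup>2"
  by (simp add: power2_norm_eq_inner inner_vec_def sum_2)

text \<open>These two identities turn the determinant into the monotonicity pairing of the two fields.\<close>

lemma det_eq_inner_rows:
  "- mult_i (M $ 2) \<bullet> M $ 1 = det (M :: real^2^2)" "mult_i (M $ 1) \<bullet> M $ 2 = det (M :: real^2^2)"
  by (simp_all add: mult_i_def inner_vec_def sum_2 det_2)

lemma matrix_of_rows_eta: "matrix_of_rows (M $ 1) (M $ 2) = M"
  by (simp add: matrix_of_rows_def vec_eq_iff forall_2)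

theorem proposition1p3:
  fixes K :: "(real^2^2) set"
  assumes "smooth_submanifold 1 K"
    and "compact K"
    and "connected K"
    and "no_rank_one_connections K"
    and "elliptic K"
  shows "\<exists>l>0. \<exists>G1 G2 :: real^2 \<Rightarrow> real^2.
           smooth_on G1 UNIV \<and> smooth_on G2 UNIV \<and>
           (\<exists>L. L-lipschitz_on UNIV G1) \<and> (\<exists>L. L-lipschitz_on UNIV G2) \<and>
           K \<subseteq> {matrix_of_rows A (mult_i (G1 A)) | A. True}
                \<inter> {matrix_of_rows (- mult_i (G2 B)) B | B. True} \<and>
           uniformly_monotone l G1 \<and> uniformly_monotone l G2"
proof (cases "K = {}")
  case True
  have "smooth_on (\<lambda>x::real^2. x) UNIV" "1-lipschitz_on UNIV (\<lambda>x::real^2. x)"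
    "uniformly_monotone 1 (\<lambda>x::real^2. x)"
    by (auto simp: uniformly_monotone_def power2_norm_eq_inner
        intro: smooth_on_linear bounded_linear_ident lipschitz_onI)
  then show ?thesis using True
    by (intro exI[of _ "1::real"] conjI exI[of _ "\<lambda>x::real^2. x"]) auto
next
  case False
  obtain C where C: "0 < C" "\<And>M M'. M \<in> K \<Longrightarrow> M' \<in> K \<Longrightarrow> (norm (M - M'))\<^sup>2 \<le> C * det (M - M')"
    using assms(5) unfolding elliptic_def by metis
  have bl: "bounded_linear (\<lambda>M :: real^2^2. M $ i)" for i by (rule bounded_linear_vec_nth)
  have blm: "bounded_linear (\<lambda>M :: real^2^2. mult_i (M $ i))" for i
    by (rule bounded_linear_compose[OF linear_linear[THEN iffD2, OF linear_mult_i] bl])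
  have norm_eq: "(norm M)\<^sup>2 = (norm (M $ 1))\<^sup>2 + (norm (- mult_i (M $ 2)))\<^sup>2"
    "(norm M)\<^sup>2 = (norm (M $ 2))\<^sup>2 + (norm (mult_i (M $ 1)))\<^sup>2" for M :: "real^2^2"
    by (simp_all add: norm_mult_i norm_rows)
  have ell: "(norm (M - M'))\<^sup>2 \<le> C * (- mult_i ((M - M') $ 2) \<bullet> (M - M') $ 1)"
    "(norm (M - M'))\<^sup>2 \<le> C * (mult_i ((M - M') $ 1) \<bullet> (M - M') $ 2)" if "M \<in> K" "M' \<in> K" for M M'
    using C(2)[OF that] by (simp_all only: det_eq_inner_rows)
  obtain l1 G1 L1 where G1: "0 < l1" "smooth_on G1 UNIV" "L1-lipschitz_on UNIV G1"
    "\<And>M. M \<in> K \<Longrightarrow> G1 (M $ 1) = - mult_i (M $ 2)"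
    "\<And>X X'. l1 * (norm (X - X'))\<^sup>2 \<le> (G1 X - G1 X') \<bullet> (X - X')"
    by (rule smooth_monotone_field[OF assms(1,2) False bl[of 1] bounded_linear_minus[OF blm[of 2]] norm_eq(1) C(1) ell(1)])
      (assumption, assumption, rule that)
  obtain l2 G2 L2 where G2: "0 < l2" "smooth_on G2 UNIV" "L2-lipschitz_on UNIV G2"
    "\<And>M. M \<in> K \<Longrightarrow> G2 (M $ 2) = mult_i (M $ 1)"
    "\<And>X X'. l2 * (norm (X - X'))\<^sup>2 \<le> (G2 X - G2 X') \<bullet> (X - X')"
    by (rule smooth_monotone_field[OF assms(1,2) False bl[of 2] blm[of 1] norm_eq(2) C(1) ell(2)])
      (assumption, assumption, rule that)
  have mono: "uniformly_monotone (min l1 l2) G1" "uniformly_monotone (min l1 l2) G2"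
    unfolding uniformly_monotone_def
    using G1(5) G2(5) by (meson min.cobounded1 min.cobounded2 mult_right_mono order_trans zero_le_power2)+
  have "M = matrix_of_rows (M $ 1) (mult_i (G1 (M $ 1)))" if "M \<in> K" for M
    using G1(4)[OF that] by (simp add: mult_i_mult_i matrix_of_rows_eta)
  moreover have "M = matrix_of_rows (- mult_i (G2 (M $ 2))) (M $ 2)" if "M \<in> K" for M
    using G2(4)[OF that] by (simp add: mult_i_mult_i matrix_of_rows_eta)
  ultimately have "K \<subseteq> {matrix_of_rows A (mult_i (G1 A)) | A. True}
      \<inter> {matrix_of_rows (- mult_i (G2 B)) B | B. True}" by blast
  moreover have "0 < min l1 l2" using G1(1) G2(1) by simp
  ultimately show ?thesis using G1(2,3) G2(2,3) mono by blast
qed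

end
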